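(* Let $(A,\prec,\succ)$ be a dendriform algebra with associated associative algebra $(A,\star)$, $a\star b=a\prec b+a\succ b$, and let $M$ be a representation of $(A,\prec,\succ)$, regarded as an $(A,\star)$-bimodule via $am=a\prec m+a\succ m$, $ma=m\prec a+m\succ a$. Then the map $$S:C^n_{\mathrm{dend}}(A,M)\to C^n_{\mathrm{Hoch}}(A,M),\qquad S(f)=f_{[1]}+\cdots+f_{[n]},$$ where $f_{[r]}(a_1,\ldots,a_n):=f([r];a_1,\ldots,a_n)$, commutes with the differentials, i.e. $\delta_{\mathrm{Hoch}}\circ S=S\circ\delta_{\mathrm{dend}}$. Thus it induces a map $S_*:H^n_{\mathrm{dend}}(A,M)\to H^n_{\mathrm{Hoch}}(A,M)$. Moreover, when $M=A$, the induced map $S_*:H^\bullet_{\mathrm{dend}}(A,A)\to H^\bullet_{\mathrm{Hoch}}(A,A)$ is a morphism of Gerstenhaber algebras.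
   Context: $\mathbb{K}$ is a field of characteristic $0$; all spaces and maps are over $\mathbb{K}$. Dendriform algebra: a vector space $A$ with bilinear $\prec,\succ$ satisfying (D1) $(a\prec b)\prec c=a\prec(b\prec c+b\succ c)$, (D2) $(a\succ b)\prec c=a\succ(b\prec c)$, (D3) $(a\prec b+a\succ b)\succ c=a\succ(b\succ c)$. The product $\star=\prec+\succ$ is associative. A representation of $A$ is a vector space $M$ with bilinear maps $\prec,\succ:A\otimes M\to M$ and $\prec,\succ:M\otimes A\to M$ such that (D1)-(D3) hold whenever exactly one of $a,b,c$ is in $M$ and the other two are in $A$ (9 identities). $A$ is a representation of itself. $C_n=\{[1],\ldots,[n]\}$ is a set of $n$ symbols, $\mathbb{K}[C_n]$ the vector space with basis $C_n$. For $1\le i\le m$, $n\ge 1$: $R_0^{m,n,i}:C_{m+n-1}\to C_m$ sends $[r]$ to $[r]$ if $r\le i-1$, to $[i]$ if $i\le r\le i+n-1$, to $[r-n+1]$ if $r\ge i+n$; $R^{m,n,i}:C_{m+n-1}\to\mathbb{K}[C_n]$ sends $[r]$ to $[r-i+1]$ if $i\le r\le i+n-1$ and to $[1]+\cdots+[n]$ otherwise. Put $\pi_A([1];a,b)=a\prec b$, $\pi_A([2];a,b)=a\succ b$; likewise $\theta_1([1];a,m)=a\prec m$, $\theta_1([2];a,m)=a\succ m$, $\theta_2([1];m,a)=m\prec a$, $\theta_2([2];m,a)=m\succ a$. Dendriform cochains: $C^n_{\mathrm{dend}}(A,M)=\mathrm{Hom}_{\mathbb{K}}(\mathbb{K}[C_n]\otimes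 A^{\otimes n},M)$, $n\ge1$, with $$(\delta_{\mathrm{dend}}f)([r];a_1,\ldots,a_{n+1})=\theta_1\big(R_0^{2,n,2}[r];a_1,f(R^{2,n,2}[r];a_2,\ldots,a_{n+1})\big)$$ $$+\sum_{i=1}^n(-1)^i f\big(R_0^{n,2,i}[r];a_1,\ldots,a_{i-1},\pi_A(R^{n,2,i}[r];a_i,a_{i+1}),a_{i+2},\ldots,a_{n+1}\big)$$ $$+(-1)^{n+1}\theta_2\big(R_0^{2,n,1}[r];f(R^{2,n,1}[r];a_1,\ldots,a_n),a_{n+1}\big).$$ This squares to zero; the cohomology is $H^n_{\mathrm{dend}}(A,M)$. $C^n_{\mathrm{Hoch}}(A,M)=\mathrm{Hom}_{\mathbb{K}}(A^{\otimes n},M)$, $n\ge1$, carries the usual Hochschild differential for $(A,\star)$. Both complexes are taken to start in degree $n=1$. Gerstenhaber structures: let $\mathcal{O}(n)=C^n_{\mathrm{dend}}(A,A)$ with the operadic partial compositions $(f\circ_i g)([r];a_1,\ldots,a_{m+n-1})=f(R_0^{m,n,i}[r];a_1,\ldots,a_{i-1},g(R^{m,n,i}[r];a_i,\ldots,a_{i+n-1}),a_{i+n},\ldots)$ and multiplication $\pi=\pi_A\in\mathcal{O}(2)$; and let $\mathrm{End}_A(n)=\mathrm{Hom}_{\mathbb{K}}(A^{\otimes n},A)$ with the usual partial compositions (insertion in the $i$-th slot) and multiplication $\pi=\star$. For any non-symmetric operad with $\pi\in\mathcal{O}(2)$, $\pi\circ_1\pi=\pi\circ_2\pi$, one sets,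 for $f\in\mathcal{O}(m)$, $g\in\mathcal{O}(n)$: $f\circ g=\sum_{i=1}^m(-1)^{(i-1)(n-1)}f\circ_i g$, $[f,g]=f\circ g-(-1)^{(m-1)(n-1)}g\circ f$, $f\cdot g=(-1)^{mn}(\pi\circ_2 g)\circ_1 f$, and $d_\pi f=\pi\circ f-(-1)^{m-1}f\circ\pi$. The bracket and product induce a Gerstenhaber algebra structure on $H^\bullet(\mathcal{O},d_\pi)$. In the two cases above $d_\pi$ agrees up to the sign $(-1)^{m-1}$ with $\delta_{\mathrm{dend}}$, respectively $\delta_{\mathrm{Hoch}}$, so it gives Gerstenhaber structures on $H^\bullet_{\mathrm{dend}}(A,A)$ and $H^\bullet_{\mathrm{Hoch}}(A,A)$. A morphism of Gerstenhaber algebras is a graded linear map preserving the product and the bracket. *)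

theory Defs
  imports Complex_Main "HOL-Library.Function_Algebras"
begin

text \<open>
  Vector spaces are carried by whole types of class \<open>ab_group_add\<close>, with an explicit
  scalar multiplication over the ground field. Functions into such a type form an abelian
  group pointwise (\<open>HOL-Library.Function_Algebras\<close>).
\<close>

section \<open>Dendriform algebras, representations, associative algebras, bimodules\<close>

record ('k, 'a) dendriform =
  dscale :: "'k \<Rightarrow> 'a \<Rightarrow> 'a"
  dprec :: "'a \<Rightarrow> 'a \<Rightarrow> 'a"
  dsucc :: "'a \<Rightarrow> 'a \<Rightarrow> 'a"

record ('k, 'a, 'm) dend_rep =
  rscale :: "'k \<Rightarrow> 'm \<Rightarrow> 'm"
  lprec :: "'a \<Rightarrow> 'm \<Rightarrow> 'm"
  lsucc :: "'a \<Rightarrow> 'm \<Rightarrow> 'm"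
  rprec :: "'m \<Rightarrow> 'a \<Rightarrow> 'm"
  rsucc :: "'m \<Rightarrow> 'a \<Rightarrow> 'm"

record ('k, 'a) algebra =
  ascale :: "'k \<Rightarrow> 'a \<Rightarrow> 'a"
  amult :: "'a \<Rightarrow> 'a \<Rightarrow> 'a"

record ('k, 'a, 'm) bimodule =
  bscale :: "'k \<Rightarrow> 'm \<Rightarrow> 'm"
  lact :: "'a \<Rightarrow> 'm \<Rightarrow> 'm"
  ract :: "'m \<Rightarrow> 'a \<Rightarrow> 'm"

definition bilinear_map ::
  "('k::field \<Rightarrow> 'a::ab_group_add \<Rightarrow> 'a) \<Rightarrow> ('k \<Rightarrow> 'b::ab_group_add \<Rightarrow> 'b)
    \<Rightarrow> ('k \<Rightarrow> 'c::ab_group_add \<Rightarrow> 'c) \<Rightarrow> ('a \<Rightarrow> 'b \<Rightarrow> 'c) \<Rightarrow> bool" where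
  "bilinear_map s1 s2 s3 h \<longleftrightarrow>
     (\<forall>y. Vector_Spaces.linear s1 s3 (\<lambda>x. h x y)) \<and> (\<forall>x. Vector_Spaces.linear s2 s3 (h x))"

definition dstar :: "('k, 'a::ab_group_add) dendriform \<Rightarrow> 'a \<Rightarrow> 'a \<Rightarrow> 'a" where
  "dstar A a b = dprec A a b + dsucc A a b"

definition dendriform_algebra :: "('k::field, 'a::ab_group_add) dendriform \<Rightarrow> bool" where
  "dendriform_algebra A \<longleftrightarrow>
     vector_space (dscale A) \<and>
     bilinear_map (dscale A) (dscale A) (dscale A) (dprec A) \<and>
     bilinear_map (dscale A) (dscale A) (dscale A) (dsucc A) \<and>
     (\<forall>a b c. dprec A (dprec A a b) c = dprec A a (dprec A b c + dsucc A b c)) \<and>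
     (\<forall>a b c. dprec A (dsucc A a b) c = dsucc A a (dprec A b c)) \<and>
     (\<forall>a b c. dsucc A (dprec A a b + dsucc A a b) c = dsucc A a (dsucc A b c))"

definition dend_representation ::
  "('k::field, 'a::ab_group_add) dendriform \<Rightarrow> ('k, 'a, 'm::ab_group_add) dend_rep \<Rightarrow> bool" where
  "dend_representation A M \<longleftrightarrow>
     vector_space (rscale M) \<and>
     bilinear_map (dscale A) (rscale M) (rscale M) (lprec M) \<and>
     bilinear_map (dscale A) (rscale M) (rscale M) (lsucc M) \<and>
     bilinear_map (rscale M) (dscale A) (rscale M) (rprec M) \<and>
     bilinear_map (rscale M) (dscale A) (rscale M) (rsucc M) \<and>
     (\<forall>m b c. rprec M (rprec M m b) c = rprec M m (dprec A b c + dsucc A b c)) \<and>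
     (\<forall>a m c. rprec M (lprec M a m) c = lprec M a (rprec M m c + rsucc M m c)) \<and>
     (\<forall>a b m. lprec M (dprec A a b) m = lprec M a (lprec M b m + lsucc M b m)) \<and>
     (\<forall>m b c. rprec M (rsucc M m b) c = rsucc M m (dprec A b c)) \<and>
     (\<forall>a m c. rprec M (lsucc M a m) c = lsucc M a (rprec M m c)) \<and>
     (\<forall>a b m. lprec M (dsucc A a b) m = lsucc M a (lprec M b m)) \<and>
     (\<forall>m b c. rsucc M (rprec M m b + rsucc M m b) c = rsucc M m (dsucc A b c)) \<and>
     (\<forall>a m c. rsucc M (lprec M a m + lsucc M a m) c = lsucc M a (rsucc M m c)) \<and>
     (\<forall>a b m. lsucc M (dprec A a b + dsucc A a b) m = lsucc M a (lsucc M b m))"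

definition self_rep :: "('k, 'a) dendriform \<Rightarrow> ('k, 'a, 'a) dend_rep" where
  "self_rep A = \<lparr>rscale = dscale A, lprec = dprec A, lsucc = dsucc A,
                 rprec = dprec A, rsucc = dsucc A\<rparr>"

lemma self_rep_representation: "dendriform_algebra A \<Longrightarrow> dend_representation A (self_rep A)"
  by (simp add: dendriform_algebra_def dend_representation_def self_rep_def)

definition assoc_of :: "('k, 'a::ab_group_add) dendriform \<Rightarrow> ('k, 'a) algebra" where
  "assoc_of A = \<lparr>ascale = dscale A, amult = dstar A\<rparr>"

definition bimod_of :: "('k, 'a, 'm::ab_group_add) dend_rep \<Rightarrow> ('k, 'a, 'm) bimodule" where
  "bimod_of M = \<lparr>bscale = rscale M,
                 lact = (\<lambda>a m. lprec M a m + lsucc M a m),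
                 ract = (\<lambda>m a. rprec M m a + rsucc M m a)\<rparr>"


section \<open>Cochain complexes and their cohomology\<close>

text \<open>\<open>alt k x\<close> is \<open>(-1)^k x\<close>.\<close>

definition alt :: "nat \<Rightarrow> 'x::ab_group_add \<Rightarrow> 'x" where
  "alt k x = (if even k then x else - x)"

text \<open>
  All complexes start in degree 1. The operation \<open>codiff C n\<close> is the differential from
  degree \<open>n\<close> to degree \<open>n + 1\<close>; whatever a complex contains in degree 0 is ignored.
\<close>

record ('k, 'x) cochain_complex =
  cochains :: "nat \<Rightarrow> 'x set"
  cscale :: "'k \<Rightarrow> 'x \<Rightarrow> 'x"
  codiff :: "nat \<Rightarrow> 'x \<Rightarrow> 'x"

definition cocycles :: "('k, 'x::ab_group_add) cochain_complex \<Rightarrow> nat \<Rightarrow> 'x set" where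
  "cocycles C n = {f \<in> cochains C n. codiff C n f = 0}"

definition coboundaries :: "('k, 'x::ab_group_add) cochain_complex \<Rightarrow> nat \<Rightarrow> 'x set" where
  "coboundaries C n = (if n \<le> 1 then {0} else codiff C (n - 1) ` cochains C (n - 1))"

definition coh_class :: "('k, 'x::ab_group_add) cochain_complex \<Rightarrow> nat \<Rightarrow> 'x \<Rightarrow> 'x set" where
  "coh_class C n f = {g \<in> cochains C n. g - f \<in> coboundaries C n}"

definition cohomology :: "('k, 'x::ab_group_add) cochain_complex \<Rightarrow> nat \<Rightarrow> 'x set set" where
  "cohomology C n = coh_class C n ` cocycles C n"

text \<open>
  Operations induced on cohomology classes (degree of the result: \<open>n\<close>), in the style of
  \<open>HOL.Equiv_Relations\<close>: the union, over all representatives, of the classes of the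
  results. If the operation on cochains respects classes, this is the class of the result
  for any choice of representatives.
\<close>

definition induced_map ::
  "('k, 'y::ab_group_add) cochain_complex \<Rightarrow> nat \<Rightarrow> ('x \<Rightarrow> 'y) \<Rightarrow> 'x set \<Rightarrow> 'y set" where
  "induced_map D n \<phi> X = (\<Union>f\<in>X. coh_class D n (\<phi> f))"

definition induced_op ::
  "('k, 'x::ab_group_add) cochain_complex \<Rightarrow> nat \<Rightarrow> ('x \<Rightarrow> 'x \<Rightarrow> 'x) \<Rightarrow> 'x set \<Rightarrow> 'x set \<Rightarrow> 'x set" where
  "induced_op C n \<phi> X Y = (\<Union>f\<in>X. \<Union>g\<in>Y. coh_class C n (\<phi> f g))"


section \<open>Graded vector spaces and Gerstenhaber algebras\<close>

text \<open>
  Graded spaces live in degrees \<open>n \<ge> 1\<close>. The degree arguments of \<open>gprod\<close> and \<open>gbrk\<close>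
  are those of the two factors; the product has degree \<open>m + n\<close> and the bracket
  degree \<open>m + n - 1\<close>.
\<close>

record ('k, 'h) graded_space =
  gcarrier :: "nat \<Rightarrow> 'h set"
  gplus :: "nat \<Rightarrow> 'h \<Rightarrow> 'h \<Rightarrow> 'h"
  gscale :: "nat \<Rightarrow> 'k \<Rightarrow> 'h \<Rightarrow> 'h"

record ('k, 'h) gerst = "('k, 'h) graded_space" +
  gprod :: "nat \<Rightarrow> nat \<Rightarrow> 'h \<Rightarrow> 'h \<Rightarrow> 'h"
  gbrk :: "nat \<Rightarrow> nat \<Rightarrow> 'h \<Rightarrow> 'h \<Rightarrow> 'h"

definition graded_linear ::
  "('k, 'h, 'p) graded_space_scheme \<Rightarrow> ('k, 'l, 'q) graded_space_scheme
    \<Rightarrow> (nat \<Rightarrow> 'h \<Rightarrow> 'l) \<Rightarrow> bool" where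
  "graded_linear G H \<phi> \<longleftrightarrow> (\<forall>n\<ge>1.
     \<phi> n ` gcarrier G n \<subseteq> gcarrier H n \<and>
     (\<forall>x\<in>gcarrier G n. \<forall>y\<in>gcarrier G n. \<phi> n (gplus G n x y) = gplus H n (\<phi> n x) (\<phi> n y)) \<and>
     (\<forall>c. \<forall>x\<in>gcarrier G n. \<phi> n (gscale G n c x) = gscale H n c (\<phi> n x)))"

definition gerst_morphism ::
  "('k, 'h) gerst \<Rightarrow> ('k, 'l) gerst \<Rightarrow> (nat \<Rightarrow> 'h \<Rightarrow> 'l) \<Rightarrow> bool" where
  "gerst_morphism G H \<phi> \<longleftrightarrow>
     graded_linear G H \<phi> \<and>
     (\<forall>m\<ge>1. \<forall>n\<ge>1. \<forall>x\<in>gcarrier G m. \<forall>y\<in>gcarrier G n.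
        \<phi> (m + n) (gprod G m n x y) = gprod H m n (\<phi> m x) (\<phi> n y) \<and>
        \<phi> (m + n - 1) (gbrk G m n x y) = gbrk H m n (\<phi> m x) (\<phi> n y))"

definition coch_space :: "('k, 'x::ab_group_add) cochain_complex \<Rightarrow> ('k, 'x) graded_space" where
  "coch_space C = \<lparr>gcarrier = cochains C, gplus = (\<lambda>_. (+)), gscale = (\<lambda>_. cscale C)\<rparr>"

definition coh_space :: "('k, 'x::ab_group_add) cochain_complex \<Rightarrow> ('k, 'x set) graded_space" where
  "coh_space C = \<lparr>gcarrier = cohomology C,
                  gplus = (\<lambda>n. induced_op C n (+)),
                  gscale = (\<lambda>n c. induced_map C n (cscale C c))\<rparr>"

text \<open>
  The bracket and product of a non-symmetric operad with multiplication \<open>\<pi>\<close>, for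
  \<open>f\<close> of arity \<open>m\<close> and \<open>g\<close> of arity \<open>n\<close>. Partial composition is a function
  \<open>pc\<close> with \<open>pc m n i f g\<close> standing for \<open>f \<circ>\<^sub>i g\<close>.
\<close>

type_synonym 'x partial_comp = "nat \<Rightarrow> nat \<Rightarrow> nat \<Rightarrow> 'x \<Rightarrow> 'x \<Rightarrow> 'x"

definition op_circ :: "'x::ab_group_add partial_comp \<Rightarrow> nat \<Rightarrow> nat \<Rightarrow> 'x \<Rightarrow> 'x \<Rightarrow> 'x" where
  "op_circ pc m n f g = (\<Sum>i=1..m. alt ((i - 1) * (n - 1)) (pc m n i f g))"

definition op_bracket :: "'x::ab_group_add partial_comp \<Rightarrow> nat \<Rightarrow> nat \<Rightarrow> 'x \<Rightarrow> 'x \<Rightarrow> 'x" where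
  "op_bracket pc m n f g = op_circ pc m n f g - alt ((m - 1) * (n - 1)) (op_circ pc n m g f)"

definition op_prod :: "'x::ab_group_add partial_comp \<Rightarrow> 'x \<Rightarrow> nat \<Rightarrow> nat \<Rightarrow> 'x \<Rightarrow> 'x \<Rightarrow> 'x" where
  "op_prod pc \<pi> m n f g = alt (m * n) (pc (n + 1) m 1 (pc 2 n 2 \<pi> g) f)"

definition coh_gerst ::
  "('k, 'x::ab_group_add) cochain_complex \<Rightarrow> 'x partial_comp \<Rightarrow> 'x \<Rightarrow> ('k, 'x set) gerst" where
  "coh_gerst C pc \<pi> = graded_space.extend (coh_space C)
     (gerst.fields (\<lambda>m n. induced_op C (m + n) (op_prod pc \<pi> m n))
                   (\<lambda>m n. induced_op C (m + n - 1) (op_bracket pc m n)))"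


section \<open>The Hochschild complex and the endomorphism operad\<close>

text \<open>
  Linear maps from the \<open>n\<close>-fold tensor power are \<open>n\<close>-linear maps on lists of length
  \<open>n\<close>, extended by 0 to lists of other lengths so that equal maps are equal functions.
  Lists are indexed from 0: the argument written \<open>a\<^sub>i\<close> in the usual formulas is
  \<open>as ! (i - 1)\<close>.
\<close>

definition multilinear_maps ::
  "('k::field \<Rightarrow> 'a::ab_group_add \<Rightarrow> 'a) \<Rightarrow> ('k \<Rightarrow> 'm::ab_group_add \<Rightarrow> 'm) \<Rightarrow> nat
    \<Rightarrow> ('a list \<Rightarrow> 'm) set" where
  "multilinear_maps sA sM n = {f.
     (\<forall>as. length as = n \<longrightarrow> (\<forall>i<n. Vector_Spaces.linear sA sM (\<lambda>x. f (as[i := x])))) \<and>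
     (\<forall>as. length as \<noteq> n \<longrightarrow> f as = 0)}"

definition hoch_diff ::
  "('k, 'a) algebra \<Rightarrow> ('k, 'a, 'm::ab_group_add) bimodule \<Rightarrow> nat
    \<Rightarrow> ('a list \<Rightarrow> 'm) \<Rightarrow> 'a list \<Rightarrow> 'm" where
  "hoch_diff B N n f as = (if length as = n + 1 then
       lact N (as ! 0) (f (drop 1 as))
       + (\<Sum>i=1..n. alt i (f (take (i - 1) as @ [amult B (as ! (i - 1)) (as ! i)] @ drop (i + 1) as)))
       + alt (n + 1) (ract N (f (take n as)) (as ! n))
     else 0)"

definition hoch_complex ::
  "('k::field, 'a::ab_group_add) algebra \<Rightarrow> ('k, 'a, 'm::ab_group_add) bimodule
    \<Rightarrow> ('k, 'a list \<Rightarrow> 'm) cochain_complex" where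
  "hoch_complex B N = \<lparr>cochains = multilinear_maps (ascale B) (bscale N),
                       cscale = (\<lambda>c f as. bscale N c (f as)),
                       codiff = hoch_diff B N\<rparr>"

definition end_comp :: "('a list \<Rightarrow> 'a::ab_group_add) partial_comp" where
  "end_comp m n i f g as = (if length as = m + n - 1 then
       f (take (i - 1) as @ [g (take n (drop (i - 1) as))] @ drop (i - 1 + n) as) else 0)"

definition end_mult :: "('k, 'a::ab_group_add) algebra \<Rightarrow> 'a list \<Rightarrow> 'a" where
  "end_mult B as = (if length as = 2 then amult B (as ! 0) (as ! 1) else 0)"


section \<open>The dendriform complex and its operad\<close>

text \<open>
  The symbol \<open>[r]\<close> of \<open>C\<^sub>n\<close> is the number \<open>r \<in> {1..n}\<close>, and a vector of
  \<open>K[C\<^sub>n]\<close> is its coefficient function. \<open>R0 m n i\<close> and \<open>RR m n i\<close> are the maps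
  \<open>R\<^sub>0\<close> and \<open>R\<close> with upper indices \<open>m, n, i\<close>.
\<close>

definition R0 :: "nat \<Rightarrow> nat \<Rightarrow> nat \<Rightarrow> nat \<Rightarrow> nat" where
  "R0 m n i r = (if r \<le> i - 1 then r else if r \<le> i + n - 1 then i else r - n + 1)"

definition RR :: "nat \<Rightarrow> nat \<Rightarrow> nat \<Rightarrow> nat \<Rightarrow> nat \<Rightarrow> 'k::zero_neq_one" where
  "RR m n i r = (if i \<le> r \<and> r \<le> i + n - 1 then (\<lambda>s. if s = r - i + 1 then 1 else 0)
                 else (\<lambda>s. if s \<in> {1..n} then 1 else 0))"

text \<open>
  A linear map from \<open>K[C\<^sub>n]\<close> tensored with the \<open>n\<close>-th tensor power of \<open>A\<close> is given
  by its values \<open>f r as\<close> on the basis symbols \<open>[r]\<close> (and is 0 for \<open>r\<close> outside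
  \<open>{1..n}\<close>); \<open>lin_ext\<close> evaluates it at an arbitrary vector of \<open>K[C\<^sub>n]\<close>.
\<close>

definition lin_ext ::
  "('k \<Rightarrow> 'm::ab_group_add \<Rightarrow> 'm) \<Rightarrow> nat \<Rightarrow> (nat \<Rightarrow> 'a list \<Rightarrow> 'm) \<Rightarrow> (nat \<Rightarrow> 'k) \<Rightarrow> 'a list \<Rightarrow> 'm" where
  "lin_ext s n f x as = (\<Sum>r=1..n. s (x r) (f r as))"

definition pi_A :: "('k, 'a::ab_group_add) dendriform \<Rightarrow> nat \<Rightarrow> 'a list \<Rightarrow> 'a" where
  "pi_A A r as = (if length as = 2 \<and> r = 1 then dprec A (as ! 0) (as ! 1)
                  else if length as = 2 \<and> r = 2 then dsucc A (as ! 0) (as ! 1) else 0)"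

definition theta1 :: "('k, 'a, 'm) dend_rep \<Rightarrow> nat \<Rightarrow> 'a \<Rightarrow> 'm \<Rightarrow> 'm" where
  "theta1 M r = (if r = 1 then lprec M else lsucc M)"

definition theta2 :: "('k, 'a, 'm) dend_rep \<Rightarrow> nat \<Rightarrow> 'm \<Rightarrow> 'a \<Rightarrow> 'm" where
  "theta2 M r = (if r = 1 then rprec M else rsucc M)"

definition dend_cochains ::
  "('k::field, 'a::ab_group_add) dendriform \<Rightarrow> ('k, 'a, 'm::ab_group_add) dend_rep \<Rightarrow> nat
    \<Rightarrow> (nat \<Rightarrow> 'a list \<Rightarrow> 'm) set" where
  "dend_cochains A M n = {f. (\<forall>r\<in>{1..n}. f r \<in> multilinear_maps (dscale A) (rscale M) n) \<and>
                             (\<forall>r. r \<notin> {1..n} \<longrightarrow> f r = 0)}"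

definition dend_diff ::
  "('k::field, 'a::ab_group_add) dendriform \<Rightarrow> ('k, 'a, 'm::ab_group_add) dend_rep \<Rightarrow> nat
    \<Rightarrow> (nat \<Rightarrow> 'a list \<Rightarrow> 'm) \<Rightarrow> nat \<Rightarrow> 'a list \<Rightarrow> 'm" where
  "dend_diff A M n f r as = (if r \<in> {1..n + 1} \<and> length as = n + 1 then
       theta1 M (R0 2 n 2 r) (as ! 0) (lin_ext (rscale M) n f (RR 2 n 2 r) (drop 1 as))
       + (\<Sum>i=1..n. alt i (f (R0 n 2 i r)
            (take (i - 1) as
             @ [lin_ext (dscale A) 2 (pi_A A) (RR n 2 i r) [as ! (i - 1), as ! i]]
             @ drop (i + 1) as)))
       + alt (n + 1) (theta2 M (R0 2 n 1 r)
            (lin_ext (rscale M) n f (RR 2 n 1 r) (take n as)) (as ! n))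
     else 0)"

definition dend_complex ::
  "('k::field, 'a::ab_group_add) dendriform \<Rightarrow> ('k, 'a, 'm::ab_group_add) dend_rep
    \<Rightarrow> ('k, nat \<Rightarrow> 'a list \<Rightarrow> 'm) cochain_complex" where
  "dend_complex A M = \<lparr>cochains = dend_cochains A M,
                       cscale = (\<lambda>c f r as. rscale M c (f r as)),
                       codiff = dend_diff A M\<rparr>"

definition dend_comp ::
  "('k::field, 'a::ab_group_add) dendriform \<Rightarrow> (nat \<Rightarrow> 'a list \<Rightarrow> 'a) partial_comp" where
  "dend_comp A m n i f g r as = (if r \<in> {1..m + n - 1} \<and> length as = m + n - 1 then
       f (R0 m n i r)
         (take (i - 1) as
          @ [lin_ext (dscale A) n g (RR m n i r) (take n (drop (i - 1) as))]
          @ drop (i - 1 + n) as)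
     else 0)"


section \<open>The comparison map\<close>

definition S_map :: "nat \<Rightarrow> (nat \<Rightarrow> 'a list \<Rightarrow> 'm::ab_group_add) \<Rightarrow> 'a list \<Rightarrow> 'm" where
  "S_map n f = (\<Sum>r=1..n. f r)"

text \<open>
  For cochains of degree \<open>m\<close> the operadic differential
  \<open>\<pi> \<circ> f - (-1)^(m-1) f \<circ> \<pi>\<close> is \<open>(-1)^(m-1)\<close> times \<open>dend_diff\<close>, respectively
  \<open>hoch_diff\<close>, so it has the same cocycles and coboundaries as the complexes used here.
\<close>

definition dend_coh_gerst ::
  "('k::field, 'a::ab_group_add) dendriform \<Rightarrow> ('k, (nat \<Rightarrow> 'a list \<Rightarrow> 'a) set) gerst" where
  "dend_coh_gerst A = coh_gerst (dend_complex A (self_rep A)) (dend_comp A) (pi_A A)"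

definition hoch_coh_gerst ::
  "('k::field, 'a::ab_group_add) dendriform \<Rightarrow> ('k, ('a list \<Rightarrow> 'a) set) gerst" where
  "hoch_coh_gerst A =
     coh_gerst (hoch_complex (assoc_of A) (bimod_of (self_rep A))) end_comp (end_mult (assoc_of A))"

end

theory Submission imports Defs begin

text \<open>
  The reason is a single summation formula. Let \<open>f\<close> have arity \<open>m\<close> and \<open>g\<close> arity \<open>n\<close>. As \<open>[r]\<close> runs
  through \<open>C\<^bsub>m+n-1\<^esub>\<close>, the pair of \<open>R\<^sub>0 [r]\<close> and \<open>R [r]\<close> runs through \<open>([k], [1] + \<dots> + [n])\<close> for
  \<open>k \<noteq> i\<close> and through \<open>([i], [1]), \<dots>, ([i], [n])\<close>; since \<open>f\<close> is additive in its \<open>i\<close>-th argument,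
  summing over \<open>r\<close> gives \<open>S f \<circ>\<^sub>i S g\<close> (\<open>sum_R\<close>). The same formula applies to each summand of the
  dendriform differential, including the two that contain the actions on \<open>M\<close>, so \<open>S\<close> commutes
  with the differentials (\<open>S_map_dend_diff\<close>). For \<open>M = A\<close> it says that \<open>S\<close> is a morphism of operads
  (\<open>S_map_dend_comp\<close>) that maps the multiplication \<open>\<pi>\<^sub>A\<close> to \<open>\<star>\<close>. Hence \<open>S\<close> preserves the bracket and
  the product already on cochains.

  It remains to pass to cohomology classes. The operations on classes are unions over all
  representatives, and the representatives of an image class need not come from dendriform cochains;
  therefore bracket and product have to be well defined on Hochschild classes (\<open>induced_map_op\<close>).
  Nothing of the kind is needed on the dendriform side, whose operations are compared only after
  applying \<open>S\<close>. Well-definedness is proved in any non-symmetric operad with multiplication \<open>\<pi>\<close>: the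
  composition \<open>\<circ>\<close> satisfies the pre-Lie identity (\<open>circ_circ\<close>), which yields the Jacobi identity and
  so \<open>[\<pi>, [f, g]] = [[\<pi>, f], g] \<plusminus> [f, [\<pi>, g]]\<close> (\<open>d_bracket\<close>), as well as \<open>d \<circ> d = 0\<close> (\<open>d_d\<close>); the
  sequential and parallel laws of the operad yield the Leibniz rule for the product (\<open>d_cup\<close>).
\<close>


section \<open>Signs and a splitting of sums\<close>

lemma alt_0 [simp]: "alt 0 x = x"
  by (simp add: alt_def)

lemma alt_zero [simp]: "alt k 0 = 0"
  by (simp add: alt_def)

lemma alt_add: "alt k (x + y) = alt k x + alt k y"
  by (simp add: alt_def)

lemma alt_diff: "alt k (x - y) = alt k x - alt k y"
  by (simp add: alt_def)

lemma alt_sum: "alt k (\<Sum>i\<in>I. f i) = (\<Sum>i\<in>I. alt k (f i))"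
  by (simp add: alt_def sum_negf)

lemma alt_alt: "alt j (alt k x) = alt (j + k) x"
  by (simp add: alt_def)

lemma alt_eq_swap: "alt k x = y \<Longrightarrow> x = alt k y"
  by (auto simp: alt_def)

lemma alt_apply: "alt k f x = alt k (f x)"
  by (simp add: alt_def)

lemma sum_apply: "(\<Sum>i\<in>I. f i) x = (\<Sum>i\<in>I. f i x)"
  for f :: "'i \<Rightarrow> 'a \<Rightarrow> 'b::comm_monoid_add"
  by (induction I rule: infinite_finite_induct) auto

text \<open>
  The positions \<open>{1..m + n - 1}\<close> of a composite \<open>f \<circ>\<^sub>i g\<close> are those left of the inserted block,
  the \<open>n\<close> positions of the block, and those right of it.
\<close>

lemma sum_split_block:
  fixes F :: "nat \<Rightarrow> 'c::comm_monoid_add"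
  assumes "1 \<le> i" "i \<le> m" "1 \<le> n"
  shows "(\<Sum>l = 1..m + n - 1. F l) =
    (\<Sum>l = 1..<i. F l) + (\<Sum>j = 1..n. F (i + j - 1)) + (\<Sum>k = i + 1..m. F (k + n - 1))"
proof -
  have "{1..m + n - 1} = ({1..<i} \<union> {i..i + n - 1}) \<union> {i + n..m + n - 1}"
    using assms by auto
  hence "(\<Sum>l = 1..m + n - 1. F l) =
      (\<Sum>l = 1..<i. F l) + (\<Sum>l = i..i + n - 1. F l) + (\<Sum>l = i + n..m + n - 1. F l)"
    by (subst sum.union_disjoint[symmetric]; use assms in auto)+
  moreover have "(\<Sum>l = i..i + n - 1. F l) = (\<Sum>j = 1..n. F (i + j - 1))"
    by (rule sum.reindex_bij_witness[where i = "\<lambda>j. i + j - 1" and j = "\<lambda>l. l + 1 - i"])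
      (use assms in auto)
  moreover have "(\<Sum>l = i + n..m + n - 1. F l) = (\<Sum>k = i + 1..m. F (k + n - 1))"
    by (rule sum.reindex_bij_witness[where i = "\<lambda>k. k + n - 1" and j = "\<lambda>l. l + 1 - n"])
      (use assms in auto)
  ultimately show ?thesis by simp
qed

lemma sum_triangle_swap:
  fixes F :: "nat \<Rightarrow> nat \<Rightarrow> 'c::comm_monoid_add"
  shows "(\<Sum>i = 1..m. \<Sum>k = i + 1..m. F i k) = (\<Sum>k = 1..m. \<Sum>i = 1..<k. F i k)"
  unfolding sum.Sigma[OF finite_atLeastAtMost ballI[OF finite_atLeastAtMost]]
    sum.Sigma[OF finite_atLeastAtMost ballI[OF finite_atLeastLessThan]]
  by (rule sum.reindex_bij_witness[where i = "\<lambda>(k, i). (i, k)" and j = "\<lambda>(i, k). (k, i)"]) auto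


section \<open>Non-symmetric operads\<close>

text \<open>
  A non-symmetric operad of abelian groups without unit: \<open>Op n\<close> is the group of operations of
  arity \<open>n\<close>, and \<open>pc m n i f g\<close> is \<open>f \<circ>\<^sub>i g\<close>, where \<open>f\<close> has arity \<open>m\<close> and \<open>g\<close> has arity \<open>n\<close>. In the
  closure and composition laws arities and positions are at least 1, so that \<open>m + n - 1\<close> is not
  truncated.
\<close>

locale ns_operad =
  fixes Op :: "nat \<Rightarrow> 'x::ab_group_add set" and pc :: "'x partial_comp"
  assumes zero_closed: "0 \<in> Op n"
    and diff_closed: "\<lbrakk>f \<in> Op n; g \<in> Op n\<rbrakk> \<Longrightarrow> f - g \<in> Op n"
    and pc_closed: "\<lbrakk>f \<in> Op m; g \<in> Op n; 1 \<le> i; i \<le> m; 1 \<le> n\<rbrakk> \<Longrightarrow> pc m n i f g \<in> Op (m + n - 1)"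
    and pc_diff_left: "pc m n i (f - f') g = pc m n i f g - pc m n i f' g"
    and pc_diff_right: "\<lbrakk>f \<in> Op m; 1 \<le> i; i \<le> m\<rbrakk> \<Longrightarrow> pc m n i f (g - g') = pc m n i f g - pc m n i f g'"
    and pc_sequential: "\<lbrakk>1 \<le> i; i \<le> m; 1 \<le> j; j \<le> n; 1 \<le> p\<rbrakk> \<Longrightarrow>
      pc (m + n - 1) p (i + j - 1) (pc m n i f g) h = pc m (n + p - 1) i f (pc n p j g h)"
    and pc_parallel: "\<lbrakk>1 \<le> i; i < k; k \<le> m; 1 \<le> n; 1 \<le> p\<rbrakk> \<Longrightarrow>
      pc (m + n - 1) p (k + n - 1) (pc m n i f g) h = pc (m + p - 1) n i (pc m p k f h) g"
begin

lemma uminus_closed: "f \<in> Op n \<Longrightarrow> - f \<in> Op n"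
  using diff_closed[OF zero_closed, of f n] by simp

lemma add_closed: "\<lbrakk>f \<in> Op n; g \<in> Op n\<rbrakk> \<Longrightarrow> f + g \<in> Op n"
  using diff_closed[OF _ uminus_closed, of f n g] by simp

lemma alt_closed: "f \<in> Op n \<Longrightarrow> alt k f \<in> Op n"
  by (simp add: alt_def uminus_closed)

lemma sum_closed: "(\<And>i. i \<in> I \<Longrightarrow> f i \<in> Op n) \<Longrightarrow> (\<Sum>i\<in>I. f i) \<in> Op n"
  by (induction I rule: infinite_finite_induct) (auto intro: add_closed zero_closed)

lemma pc_zero_left: "pc m n i 0 g = 0"
  using pc_diff_left[of m n i 0 0 g] by simp

lemma pc_minus_left: "pc m n i (- f) g = - pc m n i f g"
  using pc_diff_left[of m n i 0 f g] by (simp add: pc_zero_left)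

lemma pc_add_left: "pc m n i (f + f') g = pc m n i f g + pc m n i f' g"
  using pc_diff_left[of m n i f "- f'" g] by (simp add: pc_minus_left)

lemma pc_alt_left: "pc m n i (alt k f) g = alt k (pc m n i f g)"
  by (simp add: alt_def pc_minus_left)

lemma pc_sum_left: "pc m n i (\<Sum>j\<in>J. f j) g = (\<Sum>j\<in>J. pc m n i (f j) g)"
  by (induction J rule: infinite_finite_induct) (auto simp: pc_zero_left pc_add_left)

context
  fixes f m i
  assumes f: "f \<in> Op m" and i: "1 \<le> i" "i \<le> m"
begin

lemma pc_zero_right: "pc m n i f 0 = 0"
  using pc_diff_right[OF f i, of n 0 0] by simp

lemma pc_minus_right: "pc m n i f (- g) = - pc m n i f g"
  using pc_diff_right[OF f i, of n 0 g] by (simp add: pc_zero_right)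

lemma pc_add_right: "pc m n i f (g + g') = pc m n i f g + pc m n i f g'"
  using pc_diff_right[OF f i, of n g "- g'"] by (simp add: pc_minus_right)

lemma pc_alt_right: "pc m n i f (alt k g) = alt k (pc m n i f g)"
  by (simp add: alt_def pc_minus_right)

lemma pc_sum_right: "pc m n i f (\<Sum>j\<in>J. g j) = (\<Sum>j\<in>J. pc m n i f (g j))"
  by (induction J rule: infinite_finite_induct) (auto simp: pc_zero_right pc_add_right)

end

abbreviation "circ \<equiv> op_circ pc"
abbreviation "bracket \<equiv> op_bracket pc"

lemma circ_closed: "\<lbrakk>f \<in> Op m; g \<in> Op n; 1 \<le> n\<rbrakk> \<Longrightarrow> circ m n f g \<in> Op (m + n - 1)"
  unfolding op_circ_def by (intro sum_closed alt_closed pc_closed) auto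

lemma bracket_closed:
  "\<lbrakk>f \<in> Op m; g \<in> Op n; 1 \<le> m; 1 \<le> n\<rbrakk> \<Longrightarrow> bracket m n f g \<in> Op (m + n - 1)"
  unfolding op_bracket_def
  using circ_closed[of f m g n] circ_closed[of g n f m]
  by (auto intro!: diff_closed alt_closed simp: add.commute)

lemma circ_diff_left: "circ m n (f - f') g = circ m n f g - circ m n f' g"
  by (simp add: op_circ_def pc_diff_left alt_diff sum_subtractf)

lemma circ_add_left: "circ m n (f + f') g = circ m n f g + circ m n f' g"
  by (simp add: op_circ_def pc_add_left alt_add sum.distrib)

lemma circ_add_right: "f \<in> Op m \<Longrightarrow> circ m n f (g + g') = circ m n f g + circ m n f g'"
  by (simp add: op_circ_def pc_add_right alt_add sum.distrib)

lemma circ_alt_left: "circ m n (alt k f) g = alt k (circ m n f g)"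
  by (simp add: op_circ_def pc_alt_left alt_sum alt_alt add.commute)

lemma circ_diff_right: "f \<in> Op m \<Longrightarrow> circ m n f (g - g') = circ m n f g - circ m n f g'"
  by (simp add: op_circ_def pc_diff_right alt_diff sum_subtractf)

lemma circ_alt_right: "f \<in> Op m \<Longrightarrow> circ m n f (alt k g) = alt k (circ m n f g)"
  by (simp add: op_circ_def pc_alt_right alt_sum alt_alt add.commute)

text \<open>
  The part of \<open>(f \<circ> g) \<circ> h\<close> in which \<open>h\<close> is inserted into an argument of \<open>f\<close> that lies left of
  the argument taken by \<open>g\<close>.
\<close>

definition crossed :: "nat \<Rightarrow> nat \<Rightarrow> nat \<Rightarrow> 'x \<Rightarrow> 'x \<Rightarrow> 'x \<Rightarrow> 'x" where
  "crossed m n p f g h = (\<Sum>i = 1..m. \<Sum>l = 1..<i.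
     alt ((i - 1) * (n - 1) + (l - 1) * (p - 1)) (pc (m + n - 1) p l (pc m n i f g) h))"

text \<open>
  The pre-Lie identity: the associator of \<open>\<circ>\<close> is graded symmetric in its last two arguments,
  because it consists of the insertions of \<open>g\<close> and \<open>h\<close> into different arguments of \<open>f\<close>.
\<close>

lemma circ_circ:
  assumes f: "f \<in> Op m" and "1 \<le> n" "1 \<le> p"
  shows "circ (m + n - 1) p (circ m n f g) h =
    crossed m n p f g h + circ m (n + p - 1) f (circ n p g h)
      + alt ((n - 1) * (p - 1)) (crossed m p n f h g)"
proof -
  define T where "T i l = alt ((i - 1) * (n - 1) + (l - 1) * (p - 1))
    (pc (m + n - 1) p l (pc m n i f g) h)" for i l
  have "circ (m + n - 1) p (circ m n f g) h = (\<Sum>l = 1..m + n - 1. \<Sum>i = 1..m. T i l)"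
    by (simp add: op_circ_def T_def pc_sum_left pc_alt_left alt_sum alt_alt add.commute)
  also have "\<dots> = (\<Sum>i = 1..m. \<Sum>l = 1..m + n - 1. T i l)"
    by (rule sum.swap)
  also have "\<dots> = (\<Sum>i = 1..m. (\<Sum>l = 1..<i. T i l) + (\<Sum>j = 1..n. T i (i + j - 1))
      + (\<Sum>k = i + 1..m. T i (k + n - 1)))"
    by (intro sum.cong refl sum_split_block) (use assms in auto)
  also have "\<dots> = crossed m n p f g h + (\<Sum>i = 1..m. \<Sum>j = 1..n. T i (i + j - 1))
      + (\<Sum>i = 1..m. \<Sum>k = i + 1..m. T i (k + n - 1))"
    by (simp add: sum.distrib crossed_def T_def)
  also have "(\<Sum>i = 1..m. \<Sum>j = 1..n. T i (i + j - 1)) = circ m (n + p - 1) f (circ n p g h)"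
  proof -
    have "T i (i + j - 1) = alt ((i - 1) * (n + p - 1 - 1))
        (alt ((j - 1) * (p - 1)) (pc m (n + p - 1) i f (pc n p j g h)))"
      if "i \<in> {1..m}" "j \<in> {1..n}" for i j
    proof -
      from that obtain i' j' where ij: "i = Suc i'" "j = Suc j'"
        by (cases i; cases j) auto
      moreover obtain n' p' where "n = Suc n'" "p = Suc p'"
        using assms by (cases n; cases p) auto
      ultimately show ?thesis
        using that assms pc_sequential[of i m j n p f g h]
        by (simp add: T_def alt_alt algebra_simps)
    qed
    thus ?thesis
      using f by (simp add: op_circ_def pc_sum_right pc_alt_right alt_sum)
  qed
  also have "(\<Sum>i = 1..m. \<Sum>k = i + 1..m. T i (k + n - 1)) =
      (\<Sum>k = 1..m. \<Sum>i = 1..<k. T i (k + n - 1))"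
    by (rule sum_triangle_swap)
  also have "\<dots> = alt ((n - 1) * (p - 1)) (crossed m p n f h g)"
  proof -
    have "T i (k + n - 1) = alt ((n - 1) * (p - 1)) (alt ((k - 1) * (p - 1) + (i - 1) * (n - 1))
        (pc (m + p - 1) n i (pc m p k f h) g))"
      if "k \<in> {1..m}" "i \<in> {1..<k}" for i k
    proof -
      from that obtain i' k' where "i = Suc i'" "k = Suc k'"
        by (cases i; cases k) auto
      moreover obtain n' p' where "n = Suc n'" "p = Suc p'"
        using assms by (cases n; cases p) auto
      ultimately show ?thesis
        using that assms pc_parallel[of i k m n p f g h]
        by (simp add: T_def alt_alt algebra_simps)
    qed
    thus ?thesis by (simp add: crossed_def alt_sum)
  qed
  finally show ?thesis .
qed

text \<open>The graded Jacobi identity, a formal consequence of the pre-Lie identity.\<close>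

lemma bracket_jacobi:
  assumes x: "x \<in> Op a" and y: "y \<in> Op b" and z: "z \<in> Op c" and ge: "1 \<le> a" "1 \<le> b" "1 \<le> c"
  shows "bracket a (b + c - 1) x (bracket b c y z) =
    bracket (a + b - 1) c (bracket a b x y) z
      + alt ((a - 1) * (b - 1)) (bracket b (a + c - 1) y (bracket a c x z))"
proof -
  obtain a' b' c' where [simp]: "a = Suc a'" "b = Suc b'" "c = Suc c'"
    using ge by (cases a; cases b; cases c) auto
  have comm: "b' + a' = a' + b'" "c' + a' = a' + c'" "c' + b' = b' + c'"
    by auto
  note C = circ_circ[of _ "Suc _" "Suc _" "Suc _", simplified]
  have xyz: "x \<in> Op (Suc a')" "y \<in> Op (Suc b')" "z \<in> Op (Suc c')"
    using x y z by auto
  note E = C[OF xyz(1), of b' c' y z] C[OF xyz(1), of c' b' z y]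
    C[OF xyz(2), of a' c' x z] C[OF xyz(2), of c' a' z x]
    C[OF xyz(3), of a' b' x y] C[OF xyz(3), of b' a' y x]
  show ?thesis
    by (simp add: op_bracket_def circ_diff_left circ_diff_right circ_alt_left circ_alt_right xyz
          E[unfolded comm] comm,
        cases "even a'"; cases "even b'"; cases "even c'"; simp add: alt_def algebra_simps)
qed

end


section \<open>Operads with multiplication\<close>

text \<open>
  An associative multiplication \<open>\<pi>\<close> in an operad. The differential is \<open>f \<mapsto> [\<pi>, f]\<close>, and \<open>cup\<close> is
  the product of the operad up to the sign \<open>(-1)^(m n)\<close>.
\<close>

locale ns_operad_mult = ns_operad Op pc
  for Op :: "nat \<Rightarrow> 'x::ab_group_add set" and pc +
  fixes \<pi> :: 'x
  assumes mult_closed: "\<pi> \<in> Op 2"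
    and mult_assoc: "pc 2 2 1 \<pi> \<pi> = pc 2 2 2 \<pi> \<pi>"
begin

definition d :: "nat \<Rightarrow> 'x \<Rightarrow> 'x" where
  "d n f = bracket 2 n \<pi> f"

definition cup :: "nat \<Rightarrow> nat \<Rightarrow> 'x \<Rightarrow> 'x \<Rightarrow> 'x" where
  "cup m n f g = pc (n + 1) m 1 (pc 2 n 2 \<pi> g) f"

lemma op_prod_eq_cup: "op_prod pc \<pi> m n f g = alt (m * n) (cup m n f g)"
  by (simp add: op_prod_def cup_def)

lemma d_diff: "d n (f - g) = d n f - d n g"
  by (simp add: d_def op_bracket_def circ_diff_left circ_diff_right mult_closed alt_diff)

lemma d_expand:
  "d n f = pc 2 n 1 \<pi> f + alt (n - 1) (pc 2 n 2 \<pi> f)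
     - alt (n - 1) (\<Sum>i = 1..n. alt (i - 1) (pc n 2 i f \<pi>))"
  by (simp add: d_def op_bracket_def op_circ_def numeral_2_eq_2)

lemma circ_mult_mult: "circ 2 2 \<pi> \<pi> = 0"
  using mult_assoc by (simp add: op_circ_def alt_def numeral_2_eq_2)

text \<open>
  The Jacobi identity gives \<open>2 d (d f) = 0\<close> only; the pre-Lie identity avoids dividing by 2. Since
  \<open>\<pi> \<circ> \<pi> = 0\<close>, it shows that \<open>(f \<circ> \<pi>) \<circ> \<pi> = 0\<close>, and that \<open>\<pi> \<circ> (\<pi> \<circ> f)\<close> is, up to sign, the
  associator \<open>(\<pi> \<circ> f) \<circ> \<pi> - \<pi> \<circ> (f \<circ> \<pi>)\<close>, which it cancels.
\<close>

lemma d_d: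
  assumes f: "f \<in> Op n" and n: "1 \<le> n"
  shows "d (n + 1) (d n f) = 0"
proof -
  obtain n' where [simp]: "n = Suc n'"
    using n by (cases n) auto
  have e1: "circ (Suc (Suc n')) 2 (circ 2 (Suc n') \<pi> f) \<pi> =
      crossed 2 (Suc n') 2 \<pi> f \<pi> + circ 2 (Suc (Suc n')) \<pi> (circ (Suc n') 2 f \<pi>)
        + alt n' (crossed 2 2 (Suc n') \<pi> \<pi> f)"
    using circ_circ[OF mult_closed, of "Suc n'" 2 f \<pi>] by simp
  have e2: "0 = crossed 2 2 (Suc n') \<pi> \<pi> f + circ 2 (Suc (Suc n')) \<pi> (circ 2 (Suc n') \<pi> f)
        + alt n' (crossed 2 (Suc n') 2 \<pi> f \<pi>)"
    using circ_circ[OF mult_closed, of 2 "Suc n'" \<pi> f]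
    by (simp add: circ_mult_mult) (simp add: op_circ_def pc_zero_left)
  have e3: "circ (Suc (Suc n')) 2 (circ (Suc n') 2 f \<pi>) \<pi> = 0"
    using circ_circ[OF f, of 2 2 \<pi> \<pi>] f
    by (simp add: circ_mult_mult) (simp add: op_circ_def pc_zero_right alt_def)
  have e4: "circ 2 (Suc (Suc n')) \<pi> (circ 2 (Suc n') \<pi> f)
      = - crossed 2 2 (Suc n') \<pi> \<pi> f - alt n' (crossed 2 (Suc n') 2 \<pi> f \<pi>)"
    using e2 by (simp add: algebra_simps eq_neg_iff_add_eq_0)
  show ?thesis
    by (cases "even n'")
      (simp_all add: d_def op_bracket_def circ_diff_left circ_diff_right circ_add_left
        circ_add_right mult_closed e1 e4 e3 alt_def)
qed

text \<open>The differential is a derivation of the bracket: the Jacobi identity with \<open>\<pi>\<close>.\<close>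

lemma d_bracket:
  assumes "f \<in> Op m" "g \<in> Op n" "1 \<le> m" "1 \<le> n"
  shows "d (m + n - 1) (bracket m n f g) =
    bracket (m + 1) n (d m f) g + alt (m - 1) (bracket m (n + 1) f (d n g))"
  using bracket_jacobi[OF mult_closed assms(1,2) _ assms(3,4)] by (simp add: d_def)

lemma bracket_antisym:
  "bracket m n f g = - alt ((m - 1) * (n - 1)) (bracket n m g f)"
  by (simp add: op_bracket_def alt_diff alt_alt mult.commute)
     (simp add: alt_def)

lemma bracket_diff_left:
  "g \<in> Op n \<Longrightarrow> bracket m n (f - f') g = bracket m n f g - bracket m n f' g"
  by (simp add: op_bracket_def circ_diff_left circ_diff_right alt_diff)

lemma bracket_diff_right:
  "f \<in> Op m \<Longrightarrow> bracket m n f (g - g') = bracket m n f g - bracket m n f g'"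
  by (simp add: op_bracket_def circ_diff_left circ_diff_right alt_diff)

lemma cup_closed:
  assumes "f \<in> Op m" "g \<in> Op n" "1 \<le> m" "1 \<le> n"
  shows "cup m n f g \<in> Op (m + n)"
proof -
  have "pc 2 n 2 \<pi> g \<in> Op (n + 1)"
    using pc_closed[OF mult_closed, of g n 2] assms by simp
  from pc_closed[OF this assms(1), of 1] show ?thesis
    using assms by (simp add: cup_def add.commute)
qed

lemma cup_diff_left:
  assumes "g \<in> Op n" "1 \<le> n"
  shows "cup m n (f - f') g = cup m n f g - cup m n f' g"
  using pc_closed[OF mult_closed, of g n 2] pc_diff_right[of "pc 2 n 2 \<pi> g" "n + 1" 1 m f f'] assms
  by (simp add: cup_def)

lemma cup_diff_right: "cup m n f (g - g') = cup m n f g - cup m n f g'"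
  by (simp add: cup_def pc_diff_left pc_diff_right mult_closed)

text \<open>
  The Leibniz rule. The insertions of \<open>\<pi>\<close> into \<open>f \<union> g\<close> are the insertions into \<open>f\<close> and those into \<open>g\<close>.
  In the usual notation the remaining summands are \<open>a (f g)\<close>, \<open>(a f) g\<close>, \<open>(f a) g\<close>, \<open>f (a g)\<close>, \<open>f (g a)\<close>
  and \<open>(f g) a\<close>; the two in the middle occur only on the right-hand side, with opposite signs.
\<close>

lemma d_cup:
  assumes f: "f \<in> Op m" and g: "g \<in> Op n" and m: "1 \<le> m" and n: "1 \<le> n"
  shows "d (m + n) (cup m n f g) = cup m (n + 1) f (d n g) + alt n (cup (m + 1) n (d m f) g)"
proof -
  have pg: "pc 2 n 2 \<pi> g \<in> Op (n + 1)"
    using pc_closed[OF mult_closed g, of 2] n by simp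
  have ins_left: "pc (m + n) 2 i (cup m n f g) \<pi> = cup (m + 1) n (pc m 2 i f \<pi>) g"
    if "i \<in> {1..m}" for i
    using that pc_sequential[of 1 "n + 1" i m 2 "pc 2 n 2 \<pi> g" f \<pi>]
    by (simp add: cup_def add.commute)
  have ins_right: "pc (m + n) 2 (m + j) (cup m n f g) \<pi> = cup m (n + 1) f (pc n 2 j g \<pi>)"
    if "j \<in> {1..n}" for j
    using that m pc_parallel[of 1 "j + 1" "n + 1" m 2 "pc 2 n 2 \<pi> g" f \<pi>]
      pc_sequential[of 2 2 j n 2 \<pi> g \<pi>]
    by (simp add: cup_def add.commute)
  have out_right: "pc 2 (m + n) 1 \<pi> (cup m n f g) = cup m (n + 1) f (pc 2 n 1 \<pi> g)"
    using m n pc_sequential[of 1 2 1 "n + 1" m \<pi> "pc 2 n 2 \<pi> g" f]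
      pc_sequential[of 1 2 2 2 n \<pi> \<pi> g] pc_sequential[of 2 2 1 2 n \<pi> \<pi> g] mult_assoc
    by (simp add: cup_def add.commute)
  have out_left: "pc 2 (m + n) 2 \<pi> (cup m n f g) = cup (m + 1) n (pc 2 m 2 \<pi> f) g"
    using m n pc_sequential[of 2 2 1 "n + 1" m \<pi> "pc 2 n 2 \<pi> g" f]
      pc_sequential[of 2 2 2 2 n \<pi> \<pi> g] pc_sequential[of 1 "n + 1" 2 2 m "pc 2 n 2 \<pi> g" \<pi> f]
      pc_parallel[of 1 2 2 2 n \<pi> \<pi> g] mult_assoc
    by (simp add: cup_def add.commute)
  have middle: "cup m (n + 1) f (pc 2 n 2 \<pi> g) = cup (m + 1) n (pc 2 m 1 \<pi> f) g"
    using m n pc_sequential[of 1 "n + 1" 1 2 m "pc 2 n 2 \<pi> g" \<pi> f]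
      pc_sequential[of 2 2 2 2 n \<pi> \<pi> g] pc_parallel[of 1 2 2 2 n \<pi> \<pi> g] mult_assoc
    by (simp add: cup_def add.commute)
  have "{1..m + n} = {1..m} \<union> {m + 1..m + n}"
    by auto
  hence "(\<Sum>i = 1..m + n. alt (i - 1) (pc (m + n) 2 i (cup m n f g) \<pi>)) =
      (\<Sum>i = 1..m. alt (i - 1) (pc (m + n) 2 i (cup m n f g) \<pi>))
      + (\<Sum>i = m + 1..m + n. alt (i - 1) (pc (m + n) 2 i (cup m n f g) \<pi>))"
    by (simp add: sum.union_disjoint disjoint_iff)
  also have "(\<Sum>i = m + 1..m + n. alt (i - 1) (pc (m + n) 2 i (cup m n f g) \<pi>)) =
      (\<Sum>j = 1..n. alt (m + j - 1) (pc (m + n) 2 (m + j) (cup m n f g) \<pi>))"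
    by (rule sum.reindex_bij_witness[where i = "\<lambda>j. m + j" and j = "\<lambda>i. i - m"]) auto
  finally have inner: "(\<Sum>i = 1..m + n. alt (i - 1) (pc (m + n) 2 i (cup m n f g) \<pi>)) =
      (\<Sum>i = 1..m. alt (i - 1) (cup (m + 1) n (pc m 2 i f \<pi>) g))
      + alt m (\<Sum>j = 1..n. alt (j - 1) (cup m (n + 1) f (pc n 2 j g \<pi>)))"
    by (simp add: ins_left ins_right alt_sum alt_alt)
  have right: "cup m (n + 1) f (d n g) = cup m (n + 1) f (pc 2 n 1 \<pi> g)
      + alt (n - 1) (cup m (n + 1) f (pc 2 n 2 \<pi> g))
      - alt (n - 1) (\<Sum>j = 1..n. alt (j - 1) (cup m (n + 1) f (pc n 2 j g \<pi>)))"
    unfolding d_expand cup_def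
    by (simp add: pc_diff_right[OF mult_closed] pc_add_right[OF mult_closed]
      pc_alt_right[OF mult_closed] pc_sum_right[OF mult_closed]
      pc_diff_left pc_add_left pc_alt_left pc_sum_left)
  have left: "cup (m + 1) n (d m f) g = cup (m + 1) n (pc 2 m 1 \<pi> f) g
      + alt (m - 1) (cup (m + 1) n (pc 2 m 2 \<pi> f) g)
      - alt (m - 1) (\<Sum>i = 1..m. alt (i - 1) (cup (m + 1) n (pc m 2 i f \<pi>) g))"
    unfolding d_expand cup_def
    by (simp add: pc_diff_right[OF pg] pc_add_right[OF pg] pc_alt_right[OF pg] pc_sum_right[OF pg]
      del: One_nat_def add_Suc_right)
  show ?thesis
    unfolding d_expand[of "m + n"] inner right left out_left out_right middle
    using m n
    by (cases m; cases n; cases "even m"; cases "even n")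
      (simp_all add: alt_def algebra_simps)
qed

end


section \<open>Cohomology classes\<close>

text \<open>A complex of abelian groups; that the differential squares to zero is not required.\<close>

locale additive_complex =
  fixes C :: "('k, 'x::ab_group_add) cochain_complex"
  assumes zero_cochain: "0 \<in> cochains C n"
    and diff_cochain: "\<lbrakk>f \<in> cochains C n; g \<in> cochains C n\<rbrakk> \<Longrightarrow> f - g \<in> cochains C n"
    and codiff_diff: "\<lbrakk>f \<in> cochains C n; g \<in> cochains C n; 1 \<le> n\<rbrakk> \<Longrightarrow>
      codiff C n (f - g) = codiff C n f - codiff C n g"
begin

lemma uminus_cochain: "f \<in> cochains C n \<Longrightarrow> - f \<in> cochains C n"
  using diff_cochain[OF zero_cochain, of f n] by simp

lemma add_cochain: "\<lbrakk>f \<in> cochains C n; g \<in> cochains C n\<rbrakk> \<Longrightarrow> f + g \<in> cochains C n"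
  using diff_cochain[OF _ uminus_cochain, of f n g] by simp

lemma alt_cochain: "f \<in> cochains C n \<Longrightarrow> alt k f \<in> cochains C n"
  by (simp add: alt_def uminus_cochain)

lemma sum_cochain: "(\<And>i. i \<in> I \<Longrightarrow> f i \<in> cochains C n) \<Longrightarrow> (\<Sum>i\<in>I. f i) \<in> cochains C n"
  by (induction I rule: infinite_finite_induct) (auto intro: add_cochain zero_cochain)

lemma codiff_zero: "1 \<le> n \<Longrightarrow> codiff C n 0 = 0"
  using codiff_diff[OF zero_cochain zero_cochain] by simp

lemma zero_coboundary: "0 \<in> coboundaries C n"
proof (cases "n \<le> 1")
  case False
  hence "0 = codiff C (n - 1) 0" by (simp add: codiff_zero)
  thus ?thesis using False zero_cochain by (auto simp: coboundaries_def)
qed (simp add: coboundaries_def)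

lemma diff_coboundary:
  assumes "x \<in> coboundaries C n" "y \<in> coboundaries C n"
  shows "x - y \<in> coboundaries C n"
proof (cases "n \<le> 1")
  case False
  then obtain f g where "f \<in> cochains C (n - 1)" "x = codiff C (n - 1) f"
      "g \<in> cochains C (n - 1)" "y = codiff C (n - 1) g"
    using assms by (auto simp: coboundaries_def)
  moreover from this have "x - y = codiff C (n - 1) (f - g)"
    using False codiff_diff[of f "n - 1" g] by simp
  ultimately show ?thesis
    using False diff_cochain by (auto simp: coboundaries_def)
qed (use assms in \<open>simp add: coboundaries_def\<close>)

lemma uminus_coboundary: "x \<in> coboundaries C n \<Longrightarrow> - x \<in> coboundaries C n"
  using diff_coboundary[OF zero_coboundary, of x n] by simp

lemma add_coboundary:
  "\<lbrakk>x \<in> coboundaries C n; y \<in> coboundaries C n\<rbrakk> \<Longrightarrow> x + y \<in> coboundaries C n"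
  using diff_coboundary[OF _ uminus_coboundary, of x n y] by simp

lemma coh_class_self: "f \<in> cochains C n \<Longrightarrow> f \<in> coh_class C n f"
  by (simp add: coh_class_def zero_coboundary)

lemma coh_class_eqI:
  assumes "g - f \<in> coboundaries C n"
  shows "coh_class C n g = coh_class C n f"
proof -
  have "h - f \<in> coboundaries C n \<longleftrightarrow> h - g \<in> coboundaries C n" for h
    using add_coboundary[OF _ assms, of "h - g"] diff_coboundary[OF _ assms, of "h - f"]
    by (auto simp: algebra_simps)
  thus ?thesis by (auto simp: coh_class_def)
qed

lemma induced_op_class:
  assumes "f \<in> cochains C m" "g \<in> cochains C n"
    and "\<And>f' g'. \<lbrakk>f' \<in> coh_class C m f; g' \<in> coh_class C n g\<rbrakk> \<Longrightarrow>
      \<phi> f' g' - \<phi> f g \<in> coboundaries C k"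
  shows "induced_op C k \<phi> (coh_class C m f) (coh_class C n g) = coh_class C k (\<phi> f g)"
proof -
  have "coh_class C k (\<phi> f' g') = coh_class C k (\<phi> f g)"
    if "f' \<in> coh_class C m f" "g' \<in> coh_class C n g" for f' g'
    using that by (intro coh_class_eqI assms(3))
  thus ?thesis
    using coh_class_self[OF assms(1)] coh_class_self[OF assms(2)]
    unfolding induced_op_def by blast
qed

end

text \<open>Induced unary operations are a case of induced binary operations.\<close>

lemma induced_map_as_op: "induced_map C n \<phi> X = induced_op C n (\<lambda>f _. \<phi> f) X X"
  by (auto simp: induced_map_def induced_op_def)

text \<open>A morphism of complexes, consisting of an additive map \<open>S n\<close> in each degree \<open>n\<close>.\<close>

locale cochain_map = C: additive_complex C + D: additive_complex D
  for C :: "('k, 'x::ab_group_add) cochain_complex"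
    and D :: "('k, 'y::ab_group_add) cochain_complex" +
  fixes S :: "nat \<Rightarrow> 'x \<Rightarrow> 'y"
  assumes map_cochain: "f \<in> cochains C n \<Longrightarrow> S n f \<in> cochains D n"
    and map_diff: "S n (f - g) = S n f - S n g"
    and map_codiff: "\<lbrakk>f \<in> cochains C n; 1 \<le> n\<rbrakk> \<Longrightarrow> codiff D n (S n f) = S (n + 1) (codiff C n f)"
begin

lemma map_zero: "S n 0 = 0"
  using map_diff[of n 0 0] by simp

lemma map_minus: "S n (- f) = - S n f"
  using map_diff[of n 0 f] by (simp add: map_zero)

lemma map_add: "S n (f + g) = S n f + S n g"
  using map_diff[of n f "- g"] by (simp add: map_minus)

lemma map_alt: "S n (alt k f) = alt k (S n f)"
  by (simp add: alt_def map_minus)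

lemma map_sum: "S n (\<Sum>i\<in>I. f i) = (\<Sum>i\<in>I. S n (f i))"
  by (induction I rule: infinite_finite_induct) (auto simp: map_zero map_add)

lemma map_cocycle: "\<lbrakk>f \<in> cocycles C n; 1 \<le> n\<rbrakk> \<Longrightarrow> S n f \<in> cocycles D n"
  by (simp add: cocycles_def map_cochain map_codiff map_zero)

lemma map_coboundary:
  assumes "x \<in> coboundaries C n"
  shows "S n x \<in> coboundaries D n"
proof (cases "n \<le> 1")
  case False
  then obtain h where h: "h \<in> cochains C (n - 1)" "x = codiff C (n - 1) h"
    using assms by (auto simp: coboundaries_def)
  hence "S n x = codiff D (n - 1) (S (n - 1) h)"
    using False map_codiff[of h "n - 1"] by simp
  thus ?thesis
    using False map_cochain[OF h(1)] by (auto simp: coboundaries_def)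
qed (use assms in \<open>simp add: coboundaries_def map_zero\<close>)

lemma map_coh_class: "f' \<in> coh_class C n f \<Longrightarrow> S n f' \<in> coh_class D n (S n f)"
  using map_coboundary[of "f' - f" n] by (simp add: coh_class_def map_cochain map_diff)

lemma induced_map_class:
  assumes "f \<in> cochains C n"
  shows "induced_map D n (S n) (coh_class C n f) = coh_class D n (S n f)"
proof -
  have "coh_class D n (S n f') = coh_class D n (S n f)" if "f' \<in> coh_class C n f" for f'
    using map_coh_class[OF that] by (intro D.coh_class_eqI) (simp add: coh_class_def)
  thus ?thesis
    using C.coh_class_self[OF assms] unfolding induced_map_def by blast
qed

text \<open>
  If \<open>S\<close> intertwines an operation of the source with an operation of the target, then the induced
  map intertwines the induced operations. Only the operation of the target has to be compatible
  with cohomology classes: all representatives of a class of the source are mapped into a single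
  class of the target.
\<close>

lemma induced_map_op:
  assumes f: "f \<in> cochains C m" and g: "g \<in> cochains C n"
    and closed: "\<And>f g. \<lbrakk>f \<in> cochains C m; g \<in> cochains C n\<rbrakk> \<Longrightarrow> \<phi> f g \<in> cochains C k"
    and comm: "\<And>f g. \<lbrakk>f \<in> cochains C m; g \<in> cochains C n\<rbrakk> \<Longrightarrow> S k (\<phi> f g) = \<psi> (S m f) (S n g)"
    and resp: "\<And>F G. \<lbrakk>F \<in> coh_class D m (S m f); G \<in> coh_class D n (S n g)\<rbrakk> \<Longrightarrow>
      \<psi> F G - \<psi> (S m f) (S n g) \<in> coboundaries D k"
  shows "induced_map D k (S k) (induced_op C k \<phi> (coh_class C m f) (coh_class C n g)) =
    induced_op D k \<psi> (coh_class D m (S m f)) (coh_class D n (S n g))"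
proof -
  have "induced_map D k (S k) (coh_class C k (\<phi> f' g')) = coh_class D k (\<psi> (S m f) (S n g))"
    if "f' \<in> coh_class C m f" "g' \<in> coh_class C n g" for f' g'
  proof -
    have coch: "f' \<in> cochains C m" "g' \<in> cochains C n"
      using that by (auto simp: coh_class_def)
    show ?thesis
      using that
      by (simp add: induced_map_class[OF closed[OF coch]] comm[OF coch]
          D.coh_class_eqI[OF resp] map_coh_class)
  qed
  moreover have "induced_map D k (S k) (induced_op C k \<phi> (coh_class C m f) (coh_class C n g)) =
    (\<Union>f'\<in>coh_class C m f. \<Union>g'\<in>coh_class C n g. induced_map D k (S k) (coh_class C k (\<phi> f' g')))"
    by (simp add: induced_map_def induced_op_def)
  ultimately have "induced_map D k (S k) (induced_op C k \<phi> (coh_class C m f) (coh_class C n g)) =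
    coh_class D k (\<psi> (S m f) (S n g))"
    using C.coh_class_self[OF f] C.coh_class_self[OF g] by blast
  also have "\<dots> = induced_op D k \<psi> (coh_class D m (S m f)) (coh_class D n (S n g))"
    by (intro D.induced_op_class[symmetric] map_cochain f g resp)
  finally show ?thesis .
qed

lemma graded_linear_cohomology:
  assumes scale_closed: "\<And>c n f. f \<in> cochains C n \<Longrightarrow> cscale C c f \<in> cochains C n"
    and map_scale: "\<And>c n f. S n (cscale C c f) = cscale D c (S n f)"
    and scale_diff: "\<And>c f g. cscale D c (f - g) = cscale D c f - cscale D c g"
    and scale_coboundary: "\<And>c n x. x \<in> coboundaries D n \<Longrightarrow> cscale D c x \<in> coboundaries D n"
  shows "graded_linear (coh_space C) (coh_space D) (\<lambda>n. induced_map D n (S n))"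
  unfolding graded_linear_def
proof (intro allI impI conjI ballI)
  fix n :: nat assume n: "1 \<le> n"
  have rep: "\<exists>f \<in> cocycles C n. X = coh_class C n f" if "X \<in> gcarrier (coh_space C) n" for X
    using that by (auto simp: coh_space_def cohomology_def)
  show "induced_map D n (S n) ` gcarrier (coh_space C) n \<subseteq> gcarrier (coh_space D) n"
    using map_cocycle[OF _ n]
    by (auto simp: coh_space_def cohomology_def induced_map_class cocycles_def)
  show "induced_map D n (S n) (gplus (coh_space C) n X Y) =
      gplus (coh_space D) n (induced_map D n (S n) X) (induced_map D n (S n) Y)"
    if XY: "X \<in> gcarrier (coh_space C) n" "Y \<in> gcarrier (coh_space C) n" for X Y
  proof -
    obtain f g where fg: "f \<in> cochains C n" "X = coh_class C n f"
        "g \<in> cochains C n" "Y = coh_class C n g"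
      using rep[OF XY(1)] rep[OF XY(2)] by (auto simp: cocycles_def)
    have "(F + G) - (S n f + S n g) \<in> coboundaries D n"
      if "F \<in> coh_class D n (S n f)" "G \<in> coh_class D n (S n g)" for F G
      using that D.add_coboundary[of "F - S n f" n "G - S n g"]
      by (simp add: coh_class_def algebra_simps)
    thus ?thesis
      using induced_map_op[of f n g n "(+)" n "(+)"] fg
      by (simp add: coh_space_def induced_map_class C.add_cochain map_add)
  qed
  show "induced_map D n (S n) (gscale (coh_space C) n c X) =
      gscale (coh_space D) n c (induced_map D n (S n) X)"
    if X: "X \<in> gcarrier (coh_space C) n" for c X
  proof -
    obtain f where f: "f \<in> cochains C n" "X = coh_class C n f"
      using rep[OF X] by (auto simp: cocycles_def)
    have "cscale D c F - cscale D c (S n f) \<in> coboundaries D n"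
      if "F \<in> coh_class D n (S n f)" for F
      using that scale_coboundary[of "F - S n f" n c] by (simp add: coh_class_def scale_diff)
    thus ?thesis
      using induced_map_op[of f n f n "\<lambda>f _. cscale C c f" n "\<lambda>f _. cscale D c f"] f
      by (simp add: coh_space_def induced_map_class induced_map_as_op[of _ _ "cscale _ _"]
          scale_closed map_scale)
  qed
qed

end


section \<open>Bracket and product of cohomology classes\<close>

text \<open>
  The complex of an operad with multiplication. The sign \<open>(-1)^(n - 1)\<close> in degree \<open>n\<close> is the one by
  which the Hochschild differential differs from \<open>d\<close>; it affects neither cocycles nor coboundaries.
\<close>

locale operad_complex = ns_operad_mult Op pc \<pi>
  for Op :: "nat \<Rightarrow> 'x::ab_group_add set" and pc \<pi> +
  fixes C :: "('k, 'x) cochain_complex"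
  assumes cochains_eq: "cochains C = Op"
    and codiff_eq: "\<lbrakk>f \<in> Op n; 1 \<le> n\<rbrakk> \<Longrightarrow> codiff C n f = alt (n - 1) (d n f)"
begin

sublocale additive_complex C
  by unfold_locales
    (auto simp: cochains_eq codiff_eq zero_closed diff_closed d_diff alt_diff)

lemma cocycle_d: "\<lbrakk>f \<in> cocycles C n; 1 \<le> n\<rbrakk> \<Longrightarrow> f \<in> Op n \<and> d n f = 0"
  by (auto simp: cocycles_def cochains_eq codiff_eq alt_def split: if_splits)

lemma d_coboundary:
  assumes "h \<in> Op n" "1 \<le> n"
  shows "d n h \<in> coboundaries C (n + 1)"
proof -
  have "d n h = codiff C n h \<or> d n h = - codiff C n h"
    using assms by (auto simp: codiff_eq alt_def)
  moreover have "codiff C n h \<in> coboundaries C (n + 1)"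
    using assms by (auto simp: coboundaries_def cochains_eq)
  ultimately show ?thesis using uminus_coboundary by auto
qed

text \<open>The first case includes degree 1, where the complex starts and \<open>0\<close> is the only coboundary.\<close>

lemma coboundary_cases:
  assumes "x \<in> coboundaries C n"
  obtains "x = 0" | h p where "1 \<le> p" "n = p + 1" "h \<in> Op p" "x = d p h"
proof (cases "n \<le> 1")
  case False
  then obtain h where h: "h \<in> Op (n - 1)" "x = codiff C (n - 1) h"
    using assms by (auto simp: coboundaries_def cochains_eq)
  define k where "k = alt (n - 1 - 1) h"
  have "d p (- h) = - d p h" for p
    using d_diff[of p 0 h] d_diff[of p 0 0] by simp
  hence "x = d (n - 1) k"
    using h False by (simp add: codiff_eq k_def alt_def)
  moreover have "k \<in> Op (n - 1)"
    unfolding k_def using h alt_closed by blast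
  ultimately show ?thesis
    using that(2)[of "n - 1"] False by simp
qed (use assms that(1) in \<open>simp add: coboundaries_def\<close>)

lemma alt_coboundary: "x \<in> coboundaries C n \<Longrightarrow> alt k x \<in> coboundaries C n"
  by (simp add: alt_def uminus_coboundary)

text \<open>All representatives of the class of a cocycle are cocycles; this uses \<open>d \<circ> d = 0\<close>.\<close>

lemma coh_class_cocycle:
  assumes "f \<in> cocycles C n" "g \<in> coh_class C n f" "1 \<le> n"
  shows "g \<in> Op n" "d n g = 0" "g - f \<in> coboundaries C n"
proof -
  show g: "g \<in> Op n" "g - f \<in> coboundaries C n"
    using assms(2) by (auto simp: coh_class_def cochains_eq)
  from g(2) have "d n (g - f) = 0"
  proof (cases rule: coboundary_cases)
    case 1
    thus ?thesis using d_diff[of n 0 0] by simp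
  next
    case (2 h p)
    thus ?thesis using d_d[of h p] by simp
  qed
  thus "d n g = 0"
    using cocycle_d[OF assms(1,3)] by (simp add: d_diff)
qed

lemma bracket_coboundary_right:
  assumes f: "f \<in> Op m" "d m f = 0" and x: "x \<in> coboundaries C n" and m: "1 \<le> m"
  shows "bracket m n f x \<in> coboundaries C (m + n - 1)"
  using x
proof (cases rule: coboundary_cases)
  case 1
  thus ?thesis using bracket_diff_right[OF f(1), of n 0 0] zero_coboundary by simp
next
  case (2 h p)
  have "bracket (m + 1) p 0 h = 0"
    using bracket_diff_left[OF \<open>h \<in> Op p\<close>, of "m + 1" 0 0] by simp
  hence "alt (m - 1) (bracket m n f x) = d (m + p - 1) (bracket m p f h)"
    using d_bracket[OF f(1) \<open>h \<in> Op p\<close> m] 2 f(2) by simp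
  hence "bracket m n f x = alt (m - 1) (d (m + p - 1) (bracket m p f h))"
    by (rule alt_eq_swap)
  moreover have "d (m + p - 1) (bracket m p f h) \<in> coboundaries C (m + n - 1)"
    using d_coboundary[OF bracket_closed[OF f(1) \<open>h \<in> Op p\<close> m]] 2 m by simp
  ultimately show ?thesis by (simp add: alt_coboundary)
qed

lemma bracket_coboundary_left:
  assumes "g \<in> Op n" "d n g = 0" "x \<in> coboundaries C m" "1 \<le> n"
  shows "bracket m n x g \<in> coboundaries C (m + n - 1)"
  using bracket_coboundary_right[OF assms] bracket_antisym[of m n x g]
  by (simp add: uminus_coboundary alt_coboundary add.commute)

lemma bracket_respects_classes:
  assumes f: "f \<in> cocycles C m" and g: "g \<in> cocycles C n" and ge: "1 \<le> m" "1 \<le> n"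
    and f': "f' \<in> coh_class C m f" and g': "g' \<in> coh_class C n g"
  shows "bracket m n f' g' - bracket m n f g \<in> coboundaries C (m + n - 1)"
proof -
  note F = cocycle_d[OF f ge(1)] and G = coh_class_cocycle[OF g g' ge(2)]
  \<comment> \<open>Both summands pair a coboundary with a cocycle: \<open>f' - f\<close> with \<open>g'\<close>, and \<open>f\<close> with \<open>g' - g\<close>.\<close>
  have "bracket m n f' g' - bracket m n f g = bracket m n (f' - f) g' + bracket m n f (g' - g)"
    using F G by (simp add: bracket_diff_left bracket_diff_right)
  thus ?thesis
    using F G bracket_coboundary_left bracket_coboundary_right coh_class_cocycle(3)[OF f f' ge(1)] ge
    by (simp add: add_coboundary)
qed

lemma cup_coboundary_right:
  assumes f: "f \<in> Op m" "d m f = 0" and x: "x \<in> coboundaries C n" and m: "1 \<le> m"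
  shows "cup m n f x \<in> coboundaries C (m + n)"
  using x
proof (cases rule: coboundary_cases)
  case 1
  thus ?thesis using cup_diff_right[of m n f 0 0] zero_coboundary by simp
next
  case (2 h p)
  have "cup (m + 1) p 0 h = 0"
    using cup_diff_left[OF \<open>h \<in> Op p\<close>, of "m + 1" 0 0] 2 by simp
  hence "cup m n f x = d (m + p) (cup m p f h)"
    using d_cup[OF f(1) \<open>h \<in> Op p\<close> m] 2 f(2) by simp
  thus ?thesis
    using d_coboundary[OF cup_closed[OF f(1) \<open>h \<in> Op p\<close> m]] 2 m by simp
qed

lemma cup_coboundary_left:
  assumes g: "g \<in> Op n" "d n g = 0" and x: "x \<in> coboundaries C m" and n: "1 \<le> n"
  shows "cup m n x g \<in> coboundaries C (m + n)"
  using x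
proof (cases rule: coboundary_cases)
  case 1
  thus ?thesis using cup_diff_left[OF g(1) n, of m 0 0] zero_coboundary by simp
next
  case (2 h p)
  have "cup p (n + 1) h 0 = 0"
    using cup_diff_right[of p "n + 1" h 0 0] by simp
  hence "alt n (cup m n x g) = d (p + n) (cup p n h g)"
    using d_cup[OF \<open>h \<in> Op p\<close> g(1) _ n] 2 g(2) by simp
  hence "cup m n x g = alt n (d (p + n) (cup p n h g))"
    by (rule alt_eq_swap)
  moreover have "d (p + n) (cup p n h g) \<in> coboundaries C (m + n)"
    using d_coboundary[OF cup_closed[OF \<open>h \<in> Op p\<close> g(1) _ n]] 2 by simp
  ultimately show ?thesis by (simp add: alt_coboundary)
qed

lemma prod_respects_classes:
  assumes f: "f \<in> cocycles C m" and g: "g \<in> cocycles C n" and ge: "1 \<le> m" "1 \<le> n"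
    and f': "f' \<in> coh_class C m f" and g': "g' \<in> coh_class C n g"
  shows "op_prod pc \<pi> m n f' g' - op_prod pc \<pi> m n f g \<in> coboundaries C (m + n)"
proof -
  note F = cocycle_d[OF f ge(1)] and G = coh_class_cocycle[OF g g' ge(2)]
  have "op_prod pc \<pi> m n f' g' - op_prod pc \<pi> m n f g =
      alt (m * n) (cup m n (f' - f) g' + cup m n f (g' - g))"
    using F G ge by (simp add: op_prod_eq_cup cup_diff_left cup_diff_right alt_diff[symmetric])
  thus ?thesis
    using F G cup_coboundary_left cup_coboundary_right coh_class_cocycle(3)[OF f f' ge(1)] ge
    by (simp add: add_coboundary alt_coboundary)
qed

end


section \<open>Multilinear maps and the endomorphism operad\<close>

lemma append_lengthE:
  assumes "length xs = a + b"
  obtains ys zs where "xs = ys @ zs" "length ys = a" "length zs = b"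
  using assms that[of "take a xs" "drop a xs"] by simp

context vector_space_pair
begin

text \<open>Linearity in each argument, with the argument marked by splitting the list around it.\<close>

lemma multilinear_maps_iff:
  "f \<in> multilinear_maps s1 s2 n \<longleftrightarrow>
     (\<forall>u w x y. length u + length w + 1 = n \<longrightarrow> f (u @ (x + y) # w) = f (u @ x # w) + f (u @ y # w)) \<and>
     (\<forall>u w c x. length u + length w + 1 = n \<longrightarrow> f (u @ s1 c x # w) = s2 c (f (u @ x # w))) \<and>
     (\<forall>as. length as \<noteq> n \<longrightarrow> f as = 0)"
    (is "_ \<longleftrightarrow> ?R")
proof
  assume "f \<in> multilinear_maps s1 s2 n"
  hence lin: "\<And>as i. length as = n \<Longrightarrow> i < n \<Longrightarrow> Vector_Spaces.linear s1 s2 (\<lambda>x. f (as[i := x]))"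
    and off: "\<And>as. length as \<noteq> n \<Longrightarrow> f as = 0"
    by (auto simp: multilinear_maps_def)
  have "Vector_Spaces.linear s1 s2 (\<lambda>x. f (u @ x # w))" if "length u + length w + 1 = n" for u w
    using lin[of "u @ 0 # w" "length u"] that by simp
  thus ?R using off by (simp add: Vector_Spaces.linear_iff)
next
  assume R: ?R
  have "Vector_Spaces.linear s1 s2 (\<lambda>x. f (as[i := x]))" if "length as = n" "i < n" for as i
  proof -
    have "length (take i as) + length (drop (Suc i) as) + 1 = n"
      using that by simp
    thus ?thesis
      using R that vs1.vector_space_axioms vs2.vector_space_axioms
      by (simp add: Vector_Spaces.linear_iff upd_conv_take_nth_drop)
  qed
  thus "f \<in> multilinear_maps s1 s2 n"
    using R by (simp add: multilinear_maps_def)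
qed

lemma zero_multilinear: "0 \<in> multilinear_maps s1 s2 n"
  by (simp add: multilinear_maps_iff)

lemma diff_multilinear:
  "\<lbrakk>f \<in> multilinear_maps s1 s2 n; g \<in> multilinear_maps s1 s2 n\<rbrakk> \<Longrightarrow> f - g \<in> multilinear_maps s1 s2 n"
  by (simp add: multilinear_maps_iff vs2.scale_right_diff_distrib)

lemma add_multilinear:
  "\<lbrakk>f \<in> multilinear_maps s1 s2 n; g \<in> multilinear_maps s1 s2 n\<rbrakk> \<Longrightarrow> f + g \<in> multilinear_maps s1 s2 n"
  by (simp add: multilinear_maps_iff vs2.scale_right_distrib)

lemma scale_multilinear:
  "f \<in> multilinear_maps s1 s2 n \<Longrightarrow> (\<lambda>as. s2 c (f as)) \<in> multilinear_maps s1 s2 n"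
  by (simp add: multilinear_maps_iff vs2.scale_right_distrib mult.commute)

lemma sum_multilinear:
  "(\<And>i. i \<in> I \<Longrightarrow> f i \<in> multilinear_maps s1 s2 n) \<Longrightarrow> (\<Sum>i\<in>I. f i) \<in> multilinear_maps s1 s2 n"
  by (induction I rule: infinite_finite_induct) (auto intro: add_multilinear zero_multilinear)

lemma multilinear_slot:
  assumes "f \<in> multilinear_maps s1 s2 n" "length u + length w + 1 = n"
  shows "f (u @ (x + y) # w) = f (u @ x # w) + f (u @ y # w)"
    and "f (u @ (x - y) # w) = f (u @ x # w) - f (u @ y # w)"
    and "f (u @ 0 # w) = 0"
proof -
  show add: "f (u @ (x + y) # w) = f (u @ x # w) + f (u @ y # w)" for x y
    using assms by (simp add: multilinear_maps_iff)
  show "f (u @ (x - y) # w) = f (u @ x # w) - f (u @ y # w)"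
    using add[of "x - y" y] by simp
  show "f (u @ 0 # w) = 0"
    using add[of 0 0] by simp
qed

lemma multilinear_slot_sum:
  assumes "f \<in> multilinear_maps s1 s2 n" "length u + length w + 1 = n"
  shows "f (u @ (\<Sum>i\<in>I. x i) # w) = (\<Sum>i\<in>I. f (u @ x i # w))"
  by (induction I rule: infinite_finite_induct)
    (auto simp: multilinear_slot[OF assms])

lemma lin_ext_multilinear:
  assumes "\<And>r. r \<in> {1..n} \<Longrightarrow> f r \<in> multilinear_maps s1 s2 n"
  shows "lin_ext s2 n f x \<in> multilinear_maps s1 s2 n"
proof -
  have "lin_ext s2 n f x = (\<Sum>r = 1..n. (\<lambda>as. s2 (x r) (f r as)))"
    by (rule ext) (simp add: lin_ext_def sum_apply)
  thus ?thesis
    using assms by (auto intro!: sum_multilinear scale_multilinear)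
qed

end

lemma bilinear_multilinear:
  assumes "bilinear_map s s s h"
  shows "(\<lambda>as. if length as = 2 then h (as ! 0) (as ! 1) else 0) \<in> multilinear_maps s s 2"
proof -
  interpret vector_space_pair s s
    using assms by (auto simp: bilinear_map_def Vector_Spaces.linear_iff vector_space_pair_def)
  have "length u + length w + 1 = 2 \<longleftrightarrow> (\<exists>z. u = [] \<and> w = [z]) \<or> (\<exists>z. u = [z] \<and> w = [])"
    for u w :: "'b list"
    by (cases u; cases w) (auto simp: length_Suc_conv)
  thus ?thesis
    using assms unfolding multilinear_maps_iff
    by (auto simp: bilinear_map_def Vector_Spaces.linear_iff)
qed

lemma end_comp_append:
  assumes "1 \<le> i" "length u = i - 1" "length v = n" "length w + i = m"
  shows "end_comp m n i f g (u @ v @ w) = f (u @ g v # w)"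
proof -
  have "length (u @ v @ w) = m + n - 1"
    using assms by simp
  thus ?thesis
    using assms by (simp add: end_comp_def)
qed

lemma end_comp_length: "length as \<noteq> m + n - 1 \<Longrightarrow> end_comp m n i f g as = 0"
  by (simp add: end_comp_def)

lemma ns_operad_End:
  assumes "vector_space s"
  shows "ns_operad (multilinear_maps s s) end_comp"
proof -
  interpret vector_space_pair s s
    using assms by (simp add: vector_space_pair_def)
  show ?thesis
  proof
    fix f :: "'b list \<Rightarrow> 'b" and g m n i
    assume f: "f \<in> multilinear_maps s s m" and g: "g \<in> multilinear_maps s s n"
      and i: "1 \<le> i" "i \<le> m" and n: "1 \<le> n"
    \<comment> \<open>An argument of \<open>f \<circ>\<^sub>i g\<close> is an argument of \<open>f\<close> left of \<open>g\<close>, an argument of \<open>g\<close>, or an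
      argument of \<open>f\<close> right of \<open>g\<close>.\<close>
    have slot: "\<exists>h. (\<forall>z. end_comp m n i f g (u @ z # w) = h z) \<and>
        (\<forall>x y. h (x + y) = h x + h y) \<and> (\<forall>c x. h (s c x) = s c (h x))"
      if uw: "length u + length w + 1 = m + n - 1" for u w
    proof -
      consider "length u < i - 1" | "i - 1 \<le> length u" "length u < i - 1 + n" | "i - 1 + n \<le> length u"
        by linarith
      thus ?thesis
      proof cases
        case 1
        hence "length w = (i - 1 - length u - 1) + (n + (m - i))"
          using uw i n by linarith
        then obtain w1 w' where w1: "w = w1 @ w'" "length w1 = i - 1 - length u - 1" "length w' = n + (m - i)"
          by (rule append_lengthE)
        from w1(3) obtain v w2 where w2: "w' = v @ w2" "length v = n" "length w2 = m - i"
          by (rule append_lengthE)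
        have len: "length (u @ z # w1) = i - 1" "length w2 + i = m" for z
          using 1 w1(2) w2(3) i by simp_all
        have "end_comp m n i f g (u @ z # w) = f (u @ z # (w1 @ g v # w2))" for z
          using end_comp_append[OF i(1) len(1) w2(2) len(2), of f g z] by (simp add: w1(1) w2(1))
        moreover have "length u + length (w1 @ g v # w2) + 1 = m"
          using len by simp
        ultimately show ?thesis
          using f unfolding multilinear_maps_iff
          by (intro exI[of _ "\<lambda>z. f (u @ z # (w1 @ g v # w2))"]) blast
      next
        case 2
        hence "length u = (i - 1) + (length u - (i - 1))"
          by linarith
        then obtain u1 u2 where u: "u = u1 @ u2" "length u1 = i - 1" "length u2 = length u - (i - 1)"
          by (rule append_lengthE)
        have "length w = (i + n - 2 - length u) + (m - i)"
          using 2 uw i n by linarith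
        then obtain w1 w2 where w: "w = w1 @ w2" "length w1 = i + n - 2 - length u" "length w2 = m - i"
          by (rule append_lengthE)
        have len: "length u2 + length w1 + 1 = n" "length w2 + i = m" "length u1 + length w2 + 1 = m"
          using 2 u(2,3) w(2,3) i n by linarith+
        have "length (u2 @ z # w1) = n" for z
          using len by simp
        from end_comp_append[OF i(1) u(2) this len(2), of f g]
        have "end_comp m n i f g (u @ z # w) = f (u1 @ g (u2 @ z # w1) # w2)" for z
          by (simp add: u(1) w(1))
        thus ?thesis
          using f g len unfolding multilinear_maps_iff
          by (intro exI[of _ "\<lambda>z. f (u1 @ g (u2 @ z # w1) # w2)"]) simp
      next
        case 3
        hence "length u = (i - 1) + (n + (length u - (i - 1) - n))"
          by linarith
        then obtain u1 u' where u1: "u = u1 @ u'" "length u1 = i - 1"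
            "length u' = n + (length u - (i - 1) - n)"
          by (rule append_lengthE)
        from u1(3) obtain v u2 where u2: "u' = v @ u2" "length v = n" "length u2 = length u - (i - 1) - n"
          by (rule append_lengthE)
        have len: "length (u2 @ z # w) + i = m" "length (u1 @ g v # u2) + length w + 1 = m" for z
          using 3 uw u1(2) u2(3) i n by simp_all
        have "end_comp m n i f g (u @ z # w) = f ((u1 @ g v # u2) @ z # w)" for z
          using end_comp_append[OF i(1) u1(2) u2(2) len(1), of f g z] by (simp add: u1(1) u2(1))
        thus ?thesis
          using f len(2) unfolding multilinear_maps_iff
          by (intro exI[of _ "\<lambda>z. f ((u1 @ g v # u2) @ z # w)"]) blast
      qed
    qed
    show "end_comp m n i f g \<in> multilinear_maps s s (m + n - 1)"
      unfolding multilinear_maps_iff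
    proof (intro conjI allI impI)
      fix u w :: "'b list" and x y c
      assume "length u + length w + 1 = m + n - 1"
      from slot[OF this] obtain h where "\<forall>z. end_comp m n i f g (u @ z # w) = h z"
        "\<forall>x y. h (x + y) = h x + h y" "\<forall>c x. h (s c x) = s c (h x)" by blast
      thus "end_comp m n i f g (u @ (x + y) # w) =
          end_comp m n i f g (u @ x # w) + end_comp m n i f g (u @ y # w)"
        and "end_comp m n i f g (u @ s c x # w) = s c (end_comp m n i f g (u @ x # w))"
        by simp_all
    qed (simp add: end_comp_length)
  next
    fix f :: "'b list \<Rightarrow> 'b" and g g' m n i
    assume f: "f \<in> multilinear_maps s s m" and i: "1 \<le> i" "i \<le> m"
    show "end_comp m n i f (g - g') = end_comp m n i f g - end_comp m n i f g'"
    proof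
      fix as :: "'b list"
      show "end_comp m n i f (g - g') as = (end_comp m n i f g - end_comp m n i f g') as"
        using i multilinear_slot(2)[OF f, of "take (i - 1) as" "drop (i - 1 + n) as"]
        by (simp add: end_comp_def)
    qed
  next
    fix f g h :: "'b list \<Rightarrow> 'b" and m n p i j :: nat
    assume ij: "1 \<le> i" "i \<le> m" "1 \<le> j" "j \<le> n" "1 \<le> p"
    show "end_comp (m + n - 1) p (i + j - 1) (end_comp m n i f g) h =
        end_comp m (n + p - 1) i f (end_comp n p j g h)"
    proof
      fix as :: "'b list"
      show "end_comp (m + n - 1) p (i + j - 1) (end_comp m n i f g) h as =
        end_comp m (n + p - 1) i f (end_comp n p j g h) as"
      proof (cases "length as = m + n - 1 + p - 1")
        case True
        hence "length as = (i - 1) + ((j - 1) + (p + ((n - j) + (m - i))))"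
          using ij by linarith
        then obtain u y where u: "as = u @ y" "length u = i - 1"
            and y: "length y = (j - 1) + (p + ((n - j) + (m - i)))"
          by (rule append_lengthE)
        from y obtain v1 y1 where v1: "y = v1 @ y1" "length v1 = j - 1"
            and y1: "length y1 = p + ((n - j) + (m - i))"
          by (rule append_lengthE)
        from y1 obtain v2 y2 where v2: "y1 = v2 @ y2" "length v2 = p"
            and y2: "length y2 = (n - j) + (m - i)"
          by (rule append_lengthE)
        from y2 obtain v3 w where v3: "y2 = v3 @ w" "length v3 = n - j" and w: "length w = m - i"
          by (rule append_lengthE)
        have "end_comp (m + n - 1) p (i + j - 1) (end_comp m n i f g) h ((u @ v1) @ v2 @ (v3 @ w)) =
            end_comp m n i f g ((u @ v1) @ h v2 # (v3 @ w))"
          by (rule end_comp_append) (use ij u(2) v1(2) v2(2) v3(2) w in simp_all)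
        moreover have "end_comp m n i f g (u @ (v1 @ h v2 # v3) @ w) = f (u @ g (v1 @ h v2 # v3) # w)"
          by (rule end_comp_append) (use ij u(2) v1(2) v2(2) v3(2) w in simp_all)
        moreover have "end_comp m (n + p - 1) i f (end_comp n p j g h) (u @ (v1 @ v2 @ v3) @ w) =
            f (u @ end_comp n p j g h (v1 @ v2 @ v3) # w)"
          by (rule end_comp_append) (use ij u(2) v1(2) v2(2) v3(2) w in simp_all)
        moreover have "end_comp n p j g h (v1 @ v2 @ v3) = g (v1 @ h v2 # v3)"
          by (rule end_comp_append) (use ij v1(2) v2(2) v3(2) in simp_all)
        ultimately show ?thesis
          by (simp add: u(1) v1(1) v2(1) v3(1))
      qed (use ij in \<open>simp add: end_comp_length\<close>)
    qed
  next
    fix f g h :: "'b list \<Rightarrow> 'b" and m n p i k :: nat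
    assume ik: "1 \<le> i" "i < k" "k \<le> m" "1 \<le> n" "1 \<le> p"
    show "end_comp (m + n - 1) p (k + n - 1) (end_comp m n i f g) h =
        end_comp (m + p - 1) n i (end_comp m p k f h) g"
    proof
      fix as :: "'b list"
      show "end_comp (m + n - 1) p (k + n - 1) (end_comp m n i f g) h as =
        end_comp (m + p - 1) n i (end_comp m p k f h) g as"
      proof (cases "length as = m + n - 1 + p - 1")
        case True
        hence "length as = (i - 1) + (n + ((k - i - 1) + (p + (m - k))))"
          using ik by linarith
        then obtain u y where u: "as = u @ y" "length u = i - 1"
            and y: "length y = n + ((k - i - 1) + (p + (m - k)))"
          by (rule append_lengthE)
        from y obtain v1 y1 where v1: "y = v1 @ y1" "length v1 = n"
            and y1: "length y1 = (k - i - 1) + (p + (m - k))"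
          by (rule append_lengthE)
        from y1 obtain v2 y2 where v2: "y1 = v2 @ y2" "length v2 = k - i - 1"
            and y2: "length y2 = p + (m - k)"
          by (rule append_lengthE)
        from y2 obtain v3 w where v3: "y2 = v3 @ w" "length v3 = p" and w: "length w = m - k"
          by (rule append_lengthE)
        have "end_comp (m + n - 1) p (k + n - 1) (end_comp m n i f g) h ((u @ v1 @ v2) @ v3 @ w) =
            end_comp m n i f g ((u @ v1 @ v2) @ h v3 # w)"
          by (rule end_comp_append) (use ik u(2) v1(2) v2(2) v3(2) w in simp_all)
        moreover have "end_comp m n i f g (u @ v1 @ (v2 @ h v3 # w)) = f (u @ g v1 # (v2 @ h v3 # w))"
          by (rule end_comp_append) (use ik u(2) v1(2) v2(2) v3(2) w in simp_all)
        moreover have "end_comp (m + p - 1) n i (end_comp m p k f h) g (u @ v1 @ (v2 @ v3 @ w)) =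
            end_comp m p k f h (u @ g v1 # (v2 @ v3 @ w))"
          by (rule end_comp_append) (use ik u(2) v1(2) v2(2) v3(2) w in simp_all)
        moreover have "end_comp m p k f h ((u @ g v1 # v2) @ v3 @ w) = f ((u @ g v1 # v2) @ h v3 # w)"
          by (rule end_comp_append) (use ik u(2) v2(2) v3(2) w in simp_all)
        ultimately show ?thesis
          by (simp add: u(1) v1(1) v2(1) v3(1))
      qed (use ik in \<open>simp add: end_comp_length\<close>)
    qed
  qed (auto simp: zero_multilinear diff_multilinear end_comp_def fun_eq_iff)
qed


section \<open>Summation over the symbols\<close>

text \<open>
  The formula that makes \<open>S\<close> work. Here \<open>F k x\<close> is the value of the outer map at the symbol \<open>[k]\<close>, with
  the value \<open>x\<close> of the inner map inserted; only at the symbol \<open>[i]\<close> are the values of the inner map at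
  different symbols inserted separately, so only \<open>F i\<close> has to be additive.
\<close>

lemma sum_R:
  fixes s :: "'k::field \<Rightarrow> 'm::ab_group_add \<Rightarrow> 'm" and F :: "nat \<Rightarrow> 'm \<Rightarrow> 'c::comm_monoid_add"
  assumes "vector_space s" and i: "1 \<le> i" "i \<le> m" "1 \<le> n"
    and F: "F i (\<Sum>t = 1..n. g t as) = (\<Sum>t = 1..n. F i (g t as))"
  shows "(\<Sum>r = 1..m + n - 1. F (R0 m n i r) (lin_ext s n g (RR m n i r) as)) =
    (\<Sum>r = 1..m. F r (\<Sum>t = 1..n. g t as))"
proof -
  interpret vector_space s by fact
  have left: "F (R0 m n i l) (lin_ext s n g (RR m n i l) as) = F l (\<Sum>t = 1..n. g t as)"
    if "l \<in> {1..<i}" for l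
    using that by (cases i) (simp_all add: R0_def RR_def lin_ext_def)
  have block: "F (R0 m n i (i + j - 1)) (lin_ext s n g (RR m n i (i + j - 1)) as) = F i (g j as)"
    if "j \<in> {1..n}" for j
  proof -
    have "lin_ext s n g (RR m n i (i + j - 1)) as = (\<Sum>t = 1..n. if t = j then g t as else 0)"
      using that unfolding lin_ext_def RR_def by (intro sum.cong) auto
    also have "\<dots> = g j as"
      using that by simp
    finally show ?thesis
      using that i by (auto simp: R0_def)
  qed
  have right: "F (R0 m n i (k + n - 1)) (lin_ext s n g (RR m n i (k + n - 1)) as) =
      F k (\<Sum>t = 1..n. g t as)"
    if "k \<in> {i + 1..m}" for k
  proof -
    have "\<not> k + n - 1 \<le> i - 1" "\<not> k + n - 1 \<le> i + n - 1" "k + n - 1 - n + 1 = k"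
      using that i by auto
    thus ?thesis
      by (simp add: R0_def RR_def lin_ext_def del: One_nat_def)
  qed
  have "{1..m} = insert i ({1..<i} \<union> {i + 1..m})"
    using i by auto
  hence "(\<Sum>r = 1..m. F r (\<Sum>t = 1..n. g t as)) = F i (\<Sum>t = 1..n. g t as) +
    ((\<Sum>r = 1..<i. F r (\<Sum>t = 1..n. g t as)) + (\<Sum>r = i + 1..m. F r (\<Sum>t = 1..n. g t as)))"
    by (simp add: sum.union_disjoint disjoint_iff)
  moreover have "(\<Sum>r = 1..m + n - 1. F (R0 m n i r) (lin_ext s n g (RR m n i r) as)) =
      (\<Sum>l = 1..<i. F l (\<Sum>t = 1..n. g t as)) + (\<Sum>j = 1..n. F i (g j as))
        + (\<Sum>k = i + 1..m. F k (\<Sum>t = 1..n. g t as))"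
    unfolding sum_split_block[OF i] using left block right by simp
  ultimately show ?thesis
    using F by (simp add: add_ac)
qed


section \<open>The comparison map\<close>

lemma S_map_diff: "S_map n (f - g) = S_map n f - S_map n g"
  by (simp add: S_map_def sum_subtractf)

text \<open>A dendriform algebra together with a representation of it.\<close>

locale dendriform_representation =
  fixes A :: "('k::field, 'a::ab_group_add) dendriform"
    and M :: "('k, 'a, 'm::ab_group_add) dend_rep"
  assumes dendriform: "dendriform_algebra A"
    and representation: "dend_representation A M"
begin

sublocale vector_space_pair "dscale A" "rscale M"
  using dendriform representation
  by (simp add: vector_space_pair_def dendriform_algebra_def dend_representation_def)

abbreviation "dend \<equiv> dend_complex A M"
abbreviation "hoch \<equiv> hoch_complex (assoc_of A) (bimod_of M)"

lemma dend_simps: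
  "cochains dend = dend_cochains A M"
  "cscale dend c f = (\<lambda>r as. rscale M c (f r as))"
  "codiff dend = dend_diff A M"
  by (simp_all add: dend_complex_def)

lemma hoch_simps:
  "cochains hoch = multilinear_maps (dscale A) (rscale M)"
  "cscale hoch c g = (\<lambda>as. rscale M c (g as))"
  "codiff hoch = hoch_diff (assoc_of A) (bimod_of M)"
  by (simp_all add: hoch_complex_def assoc_of_def bimod_of_def)

lemma theta1_linear:
  "theta1 M r a (x + y) = theta1 M r a x + theta1 M r a y"
  "theta1 M r a (rscale M c x) = rscale M c (theta1 M r a x)"
  using representation
  by (auto simp: theta1_def dend_representation_def bilinear_map_def Vector_Spaces.linear_iff)

lemma theta2_linear:
  "theta2 M r (x + y) a = theta2 M r x a + theta2 M r y a"
  "theta2 M r (rscale M c x) a = rscale M c (theta2 M r x a)"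
  using representation
  by (auto simp: theta2_def dend_representation_def bilinear_map_def Vector_Spaces.linear_iff)

lemma theta1_zero: "theta1 M r a 0 = 0"
  using theta1_linear(1)[of r a 0 0] by simp

lemma theta2_zero: "theta2 M r 0 a = 0"
  using theta2_linear(1)[of r 0 0 a] by simp

lemma theta1_diff: "theta1 M r a (x - y) = theta1 M r a x - theta1 M r a y"
  using theta1_linear(1)[of r a "x - y" y] by simp

lemma theta2_diff: "theta2 M r (x - y) a = theta2 M r x a - theta2 M r y a"
  using theta2_linear(1)[of r "x - y" y a] by simp

lemma theta1_sum: "theta1 M r a (\<Sum>i\<in>I. x i) = (\<Sum>i\<in>I. theta1 M r a (x i))"
  by (induction I rule: infinite_finite_induct) (auto simp: theta1_zero theta1_linear)

lemma theta2_sum: "theta2 M r (\<Sum>i\<in>I. x i) a = (\<Sum>i\<in>I. theta2 M r (x i) a)"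
  by (induction I rule: infinite_finite_induct) (auto simp: theta2_zero theta2_linear)

lemma lact_theta: "lact (bimod_of M) a m = theta1 M 1 a m + theta1 M 2 a m"
  by (simp add: bimod_of_def theta1_def)

lemma ract_theta: "ract (bimod_of M) m a = theta2 M 1 m a + theta2 M 2 m a"
  by (simp add: bimod_of_def theta2_def)

lemma lin_ext_diff:
  "lin_ext (rscale M) n (f - g) x as = lin_ext (rscale M) n f x as - lin_ext (rscale M) n g x as"
  by (simp add: lin_ext_def vs2.scale_right_diff_distrib sum_subtractf)

lemma scale_alt: "rscale M c (alt k x) = alt k (rscale M c x)"
  by (simp add: alt_def)

lemma dend_diff_diff: "dend_diff A M n (f - g) = dend_diff A M n f - dend_diff A M n g"
  by (intro ext)
    (simp add: dend_diff_def lin_ext_diff theta1_diff theta2_diff alt_diff sum_subtractf)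

lemma hoch_diff_diff:
  "hoch_diff B (bimod_of M) n (f - g) = hoch_diff B (bimod_of M) n f - hoch_diff B (bimod_of M) n g"
  by (intro ext)
    (simp add: hoch_diff_def lact_theta ract_theta theta1_diff theta2_diff alt_diff sum_subtractf
      alt_add)

lemma hoch_diff_scale:
  "hoch_diff B (bimod_of M) n (\<lambda>as. rscale M c (f as)) =
    (\<lambda>as. rscale M c (hoch_diff B (bimod_of M) n f as))"
  by (intro ext)
    (simp add: hoch_diff_def lact_theta ract_theta theta1_linear theta2_linear scale_alt
      vs2.scale_right_distrib vs2.scale_sum_right)

lemma additive_complex_dend: "additive_complex dend"
  by standard
    (auto simp: dend_simps dend_cochains_def zero_multilinear diff_multilinear dend_diff_diff)

lemma additive_complex_hoch: "additive_complex hoch"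
  by standard (auto simp: hoch_simps zero_multilinear diff_multilinear hoch_diff_diff)

text \<open>
  The comparison map commutes with the differentials: \<open>sum_R\<close> applies to each of the \<open>n + 2\<close> summands
  of the dendriform differential separately, with \<open>theta1\<close>, \<open>f\<close> and \<open>theta2\<close> as outer maps.
\<close>

lemma S_map_dend_diff:
  assumes f: "f \<in> dend_cochains A M n" and n: "1 \<le> n"
  shows "hoch_diff (assoc_of A) (bimod_of M) n (S_map n f) = S_map (n + 1) (dend_diff A M n f)"
proof
  fix as :: "'a list"
  show "hoch_diff (assoc_of A) (bimod_of M) n (S_map n f) as = S_map (n + 1) (dend_diff A M n f) as"
  proof (cases "length as = n + 1")
    case len: True
    have S: "S_map n f bs = (\<Sum>t = 1..n. f t bs)" for bs
      by (simp add: S_map_def sum_apply)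
    have first: "(\<Sum>r = 1..n + 1. theta1 M (R0 2 n 2 r) (as ! 0)
        (lin_ext (rscale M) n f (RR 2 n 2 r) (drop 1 as))) =
        lact (bimod_of M) (as ! 0) (S_map n f (drop 1 as))"
      using sum_R[OF vs2.vector_space_axioms _ _ n, of 2 2 "\<lambda>r. theta1 M r (as ! 0)" f "drop 1 as"]
      by (simp add: theta1_sum lact_theta S numeral_2_eq_2)
    have last: "(\<Sum>r = 1..n + 1. theta2 M (R0 2 n 1 r)
        (lin_ext (rscale M) n f (RR 2 n 1 r) (take n as)) (as ! n)) =
        ract (bimod_of M) (S_map n f (take n as)) (as ! n)"
      using sum_R[OF vs2.vector_space_axioms _ _ n, of 1 2 "\<lambda>r x. theta2 M r x (as ! n)" f "take n as"]
      by (simp add: theta2_sum ract_theta S numeral_2_eq_2)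
    have inner: "(\<Sum>r = 1..n + 1. f (R0 n 2 i r) (take (i - 1) as
         @ [lin_ext (dscale A) 2 (pi_A A) (RR n 2 i r) [as ! (i - 1), as ! i]] @ drop (i + 1) as))
       = S_map n f (take (i - 1) as @ [amult (assoc_of A) (as ! (i - 1)) (as ! i)] @ drop (i + 1) as)"
      if i: "i \<in> {1..n}" for i
    proof -
      have "f i \<in> multilinear_maps (dscale A) (rscale M) n"
        using f i by (auto simp: dend_cochains_def)
      moreover have "length (take (i - 1) as) + length (drop (i + 1) as) + 1 = n"
        using len i by auto
      ultimately have slot: "f i (take (i - 1) as
            @ [\<Sum>t = 1..2. pi_A A t [as ! (i - 1), as ! i]] @ drop (i + 1) as) =
          (\<Sum>t = 1..2. f i (take (i - 1) as @ [pi_A A t [as ! (i - 1), as ! i]] @ drop (i + 1) as))"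
        unfolding append_Cons append_Nil by (rule multilinear_slot_sum)
      have "(\<Sum>t = 1..2. pi_A A t [as ! (i - 1), as ! i]) = amult (assoc_of A) (as ! (i - 1)) (as ! i)"
        by (simp add: numeral_2_eq_2 pi_A_def assoc_of_def dstar_def)
      moreover have "1 \<le> i" "i \<le> n" "n + 2 - 1 = n + 1" "1 \<le> (2::nat)"
        using i by auto
      ultimately show ?thesis
        using sum_R[where F = "\<lambda>r x. f r (take (i - 1) as @ [x] @ drop (i + 1) as)"
              and g = "pi_A A" and as = "[as ! (i - 1), as ! i]",
            OF vs1.vector_space_axioms \<open>1 \<le> i\<close> \<open>i \<le> n\<close> \<open>1 \<le> (2::nat)\<close> slot]
        by (simp only: S)
    qed
    have "S_map (n + 1) (dend_diff A M n f) as = (\<Sum>r = 1..n + 1. dend_diff A M n f r as)"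
      by (simp add: S_map_def sum_apply)
    also have "\<dots> = (\<Sum>r = 1..n + 1.
       theta1 M (R0 2 n 2 r) (as ! 0) (lin_ext (rscale M) n f (RR 2 n 2 r) (drop 1 as))
       + (\<Sum>i=1..n. alt i (f (R0 n 2 i r)
            (take (i - 1) as
             @ [lin_ext (dscale A) 2 (pi_A A) (RR n 2 i r) [as ! (i - 1), as ! i]]
             @ drop (i + 1) as)))
       + alt (n + 1) (theta2 M (R0 2 n 1 r)
            (lin_ext (rscale M) n f (RR 2 n 1 r) (take n as)) (as ! n)))"
      using len by (intro sum.cong refl) (auto simp: dend_diff_def)
    also have "\<dots> = (\<Sum>r = 1..n + 1. theta1 M (R0 2 n 2 r) (as ! 0)
          (lin_ext (rscale M) n f (RR 2 n 2 r) (drop 1 as)))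
       + (\<Sum>i=1..n. alt i (\<Sum>r = 1..n + 1. f (R0 n 2 i r)
            (take (i - 1) as
             @ [lin_ext (dscale A) 2 (pi_A A) (RR n 2 i r) [as ! (i - 1), as ! i]]
             @ drop (i + 1) as)))
       + alt (n + 1) (\<Sum>r = 1..n + 1. theta2 M (R0 2 n 1 r)
            (lin_ext (rscale M) n f (RR 2 n 1 r) (take n as)) (as ! n))"
      unfolding sum.distrib alt_sum by (subst sum.swap[of _ "{1..n}"]) (rule refl)
    also have "\<dots> = hoch_diff (assoc_of A) (bimod_of M) n (S_map n f) as"
      using len by (simp only: first last inner hoch_diff_def if_True refl cong: sum.cong)
    finally show ?thesis ..
  qed (simp add: hoch_diff_def S_map_def sum_apply dend_diff_def)
qed

lemma S_map_scale: "S_map n (cscale dend c f) = cscale hoch c (S_map n f)"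
  by (rule ext) (simp add: S_map_def sum_apply dend_simps hoch_simps vs2.scale_sum_right)

sublocale cochain_map dend hoch S_map
proof (rule cochain_map.intro[OF additive_complex_dend additive_complex_hoch], unfold_locales)
  fix f n assume f: "f \<in> cochains dend n"
  thus "S_map n f \<in> cochains hoch n"
    unfolding S_map_def by (auto simp: dend_simps hoch_simps dend_cochains_def intro!: sum_multilinear)
  show "codiff hoch n (S_map n f) = S_map (n + 1) (codiff dend n f)" if "1 \<le> n"
    using S_map_dend_diff[OF _ that, of f] f by (simp add: dend_simps hoch_simps)
qed (rule S_map_diff)

lemma dend_scale_closed: "f \<in> cochains dend n \<Longrightarrow> cscale dend c f \<in> cochains dend n"
  by (auto simp: dend_simps dend_cochains_def fun_eq_iff intro!: scale_multilinear)

lemma hoch_scale_coboundary: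
  assumes "x \<in> coboundaries hoch n"
  shows "cscale hoch c x \<in> coboundaries hoch n"
proof (cases "n \<le> 1")
  case False
  then obtain h where "h \<in> cochains hoch (n - 1)" "x = codiff hoch (n - 1) h"
    using assms by (auto simp: coboundaries_def)
  hence "cscale hoch c h \<in> cochains hoch (n - 1)"
    "cscale hoch c x = codiff hoch (n - 1) (cscale hoch c h)"
    by (simp_all add: hoch_simps scale_multilinear hoch_diff_scale)
  thus ?thesis
    using False by (auto simp: coboundaries_def)
qed (use assms in \<open>auto simp: coboundaries_def hoch_simps fun_eq_iff\<close>)

lemma graded_linear_cochains: "graded_linear (coch_space dend) (coch_space hoch) S_map"
  by (auto simp: graded_linear_def coch_space_def map_cochain map_add S_map_scale)

lemma graded_linear_cohomology_classes:
  "graded_linear (coh_space dend) (coh_space hoch) (\<lambda>n. induced_map hoch n (S_map n))"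
proof (rule graded_linear_cohomology)
  show "cscale hoch c (f - g) = cscale hoch c f - cscale hoch c g" for c f g
    by (rule ext) (simp add: hoch_simps vs2.scale_right_diff_distrib)
qed (simp_all add: dend_scale_closed S_map_scale hoch_scale_coboundary)

end


section \<open>The comparison map as a morphism of operads\<close>

locale dendriform =
  fixes A :: "('k::field, 'a::ab_group_add) dendriform"
  assumes dendriform_algebra: "dendriform_algebra A"
begin

sublocale dendriform_representation A "self_rep A"
  by unfold_locales (use dendriform_algebra self_rep_representation in auto)

abbreviation "End \<equiv> multilinear_maps (dscale A) (dscale A)"

abbreviation "\<mu> \<equiv> end_mult (assoc_of A)"

lemma rscale_self: "rscale (self_rep A) = dscale A"
  by (simp add: self_rep_def)

sublocale End: ns_operad End end_comp
  by (rule ns_operad_End) (rule vs1.vector_space_axioms)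

lemma dstar_assoc: "dstar A (dstar A a b) c = dstar A a (dstar A b c)"
proof -
  have "dprec A (x + y) z = dprec A x z + dprec A y z" "dprec A z (x + y) = dprec A z x + dprec A z y"
    "dsucc A (x + y) z = dsucc A x z + dsucc A y z" "dsucc A z (x + y) = dsucc A z x + dsucc A z y"
    for x y z
    using dendriform_algebra
    by (auto simp: dendriform_algebra_def bilinear_map_def Vector_Spaces.linear_iff)
  thus ?thesis
    using dendriform_algebra by (simp add: dendriform_algebra_def dstar_def add_ac)
qed

lemma pi_A_closed: "pi_A A \<in> cochains dend 2"
proof -
  have "pi_A A 1 = (\<lambda>as. if length as = 2 then dprec A (as ! 0) (as ! 1) else 0)"
    "pi_A A 2 = (\<lambda>as. if length as = 2 then dsucc A (as ! 0) (as ! 1) else 0)"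
    by (auto simp: pi_A_def fun_eq_iff)
  hence "pi_A A 1 \<in> End 2" "pi_A A 2 \<in> End 2"
    using dendriform_algebra by (simp_all only: bilinear_multilinear dendriform_algebra_def)
  moreover have "r = 1 \<or> r = 2" if "r \<in> {1..2}" for r :: nat
    using that by auto
  ultimately show ?thesis
    by (auto simp: dend_simps dend_cochains_def rscale_self) (auto simp: pi_A_def fun_eq_iff)
qed

lemma S_map_pi_A: "S_map 2 (pi_A A) = \<mu>"
  by (rule ext)
    (simp add: S_map_def sum_apply numeral_2_eq_2 pi_A_def end_mult_def assoc_of_def dstar_def)

lemma end_mult_multilinear: "\<mu> \<in> End 2"
  using map_cochain[OF pi_A_closed] by (simp add: S_map_pi_A hoch_simps rscale_self)

sublocale End: ns_operad_mult End end_comp \<mu>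
proof
  show "end_comp 2 2 1 \<mu> \<mu> =
      end_comp 2 2 2 \<mu> \<mu>"
  proof
    fix as :: "'a list"
    show "end_comp 2 2 1 \<mu> \<mu> as =
      end_comp 2 2 2 \<mu> \<mu> as"
    proof (cases "length as = 3")
      case True
      then obtain a b c where "as = [a, b, c]"
        by (auto simp: numeral_3_eq_3 length_Suc_conv)
      thus ?thesis
        by (simp add: end_comp_def end_mult_def assoc_of_def dstar_assoc)
    qed (simp add: end_comp_def)
  qed
qed (rule end_mult_multilinear)

text \<open>\<open>End.d\<close> is \<open>f \<mapsto> [\<star>, f]\<close> in the endomorphism operad.\<close>

lemma hoch_diff_eq_d:
  assumes n: "1 \<le> n"
  shows "hoch_diff (assoc_of A) (bimod_of (self_rep A)) n f = alt (n - 1) (End.d n f)"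
proof
  fix as :: "'a list"
  show "hoch_diff (assoc_of A) (bimod_of (self_rep A)) n f as = alt (n - 1) (End.d n f) as"
  proof (cases "length as = n + 1")
    case len: True
    have "drop n as = [as ! n]"
      using len by (metis Cons_nth_drop_Suc Suc_eq_plus1 drop_all lessI order_refl)
    hence left: "end_comp 2 n 1 \<mu> f as = ract (bimod_of (self_rep A)) (f (take n as)) (as ! n)"
      using len by (simp add: end_comp_def end_mult_def assoc_of_def bimod_of_def self_rep_def dstar_def)
    have "take (Suc 0) as = [as ! 0]"
      using len by (cases as) auto
    hence right: "end_comp 2 n 2 \<mu> f as = lact (bimod_of (self_rep A)) (as ! 0) (f (drop 1 as))"
      using len by (simp add: end_comp_def end_mult_def assoc_of_def bimod_of_def self_rep_def dstar_def)
    have inner: "end_comp n 2 i f \<mu> as =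
        f (take (i - 1) as @ [amult (assoc_of A) (as ! (i - 1)) (as ! i)] @ drop (i + 1) as)"
      if "i \<in> {1..n}" for i
      using that len by (cases i) (auto simp: end_comp_def end_mult_def)
    have "alt (n - 1) (End.d n f) as = end_comp 2 n 2 \<mu> f as
        - (\<Sum>i = 1..n. alt (i - 1) (end_comp n 2 i f \<mu> as))
        + alt (n + 1) (end_comp 2 n 1 \<mu> f as)"
      using n unfolding End.d_expand
      by (cases n) (simp_all add: sum_apply alt_apply, simp_all add: alt_def)
    also have "(\<Sum>i = 1..n. alt (i - 1) (end_comp n 2 i f \<mu> as)) =
        - (\<Sum>i = 1..n. alt i (end_comp n 2 i f \<mu> as))"
      unfolding sum_negf[symmetric] by (intro sum.cong) (auto simp: alt_def)
    finally show ?thesis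
      using len by (simp only: hoch_diff_def if_True left right inner cong: sum.cong) simp
  qed (use n in \<open>auto simp: hoch_diff_def alt_apply End.d_expand end_comp_def sum_apply\<close>)
qed

sublocale End: operad_complex End end_comp \<mu> hoch
proof
  show "cochains hoch = End"
    by (simp add: hoch_simps rscale_self)
qed (use hoch_diff_eq_d in \<open>simp add: hoch_simps\<close>)

text \<open>
  The component of a dendriform composite at a symbol is a composite in the endomorphism operad; hence
  composites of multilinear components are multilinear.
\<close>

lemma dend_comp_eq:
  "dend_comp A m n i f g r = (if r \<in> {1..m + n - 1} then
     end_comp m n i (f (R0 m n i r)) (lin_ext (dscale A) n g (RR m n i r)) else 0)"
  by (rule ext) (auto simp: dend_comp_def end_comp_def)

lemma R0_range:
  assumes "1 \<le> i" "i \<le> m" "1 \<le> n" "r \<in> {1..m + n - 1}"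
  shows "R0 m n i r \<in> {1..m}"
  using assms by (auto simp: R0_def)

lemma dend_comp_closed:
  assumes f: "f \<in> cochains dend m" and g: "g \<in> cochains dend n" and i: "1 \<le> i" "i \<le> m" "1 \<le> n"
  shows "dend_comp A m n i f g \<in> cochains dend (m + n - 1)"
proof -
  have "f (R0 m n i r) \<in> End m" if "r \<in> {1..m + n - 1}" for r
    using f R0_range[OF i that] by (auto simp: dend_simps dend_cochains_def rscale_self)
  moreover have "lin_ext (dscale A) n g x \<in> End n" for x
    using lin_ext_multilinear[of n g x] g
    by (auto simp: dend_simps dend_cochains_def rscale_self)
  ultimately have "end_comp m n i (f (R0 m n i r)) (lin_ext (dscale A) n g (RR m n i r))
      \<in> End (m + n - 1)"
    if "r \<in> {1..m + n - 1}" for r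
    using that i by (intro End.pc_closed)
  thus ?thesis
    by (simp add: dend_simps dend_cochains_def rscale_self dend_comp_eq del: One_nat_def)
qed

lemma S_map_dend_comp:
  assumes f: "f \<in> cochains dend m" and i: "1 \<le> i" "i \<le> m" and n: "1 \<le> n"
  shows "S_map (m + n - 1) (dend_comp A m n i f g) = end_comp m n i (S_map m f) (S_map n g)"
proof
  fix as :: "'a list"
  show "S_map (m + n - 1) (dend_comp A m n i f g) as = end_comp m n i (S_map m f) (S_map n g) as"
  proof (cases "length as = m + n - 1")
    case len: True
    let ?bs = "take n (drop (i - 1) as)"
    have "f i \<in> multilinear_maps (dscale A) (rscale (self_rep A)) m"
      using f i by (auto simp: dend_simps dend_cochains_def)
    moreover have "length (take (i - 1) as) + length (drop (i - 1 + n) as) + 1 = m"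
      using len i n by auto
    ultimately have slot: "f i (take (i - 1) as @ [\<Sum>t = 1..n. g t ?bs] @ drop (i - 1 + n) as) =
        (\<Sum>t = 1..n. f i (take (i - 1) as @ [g t ?bs] @ drop (i - 1 + n) as))"
      unfolding append_Cons append_Nil by (rule multilinear_slot_sum)
    have "S_map (m + n - 1) (dend_comp A m n i f g) as =
        (\<Sum>r = 1..m + n - 1. f (R0 m n i r)
          (take (i - 1) as @ [lin_ext (dscale A) n g (RR m n i r) ?bs] @ drop (i - 1 + n) as))"
      unfolding S_map_def sum_apply using len by (intro sum.cong) (auto simp: dend_comp_def)
    also have "\<dots> = (\<Sum>r = 1..m. f r (take (i - 1) as @ [\<Sum>t = 1..n. g t ?bs] @ drop (i - 1 + n) as))"
      using sum_R[where F = "\<lambda>r x. f r (take (i - 1) as @ [x] @ drop (i - 1 + n) as)"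
            and g = g and as = ?bs,
          OF vs1.vector_space_axioms i n slot] .
    also have "\<dots> = end_comp m n i (S_map m f) (S_map n g) as"
      using len by (simp add: end_comp_def S_map_def sum_apply)
    finally show ?thesis .
  qed (simp add: S_map_def sum_apply dend_comp_def end_comp_def)
qed

lemma circ_closed_dend:
  assumes "f \<in> cochains dend m" "g \<in> cochains dend n" "1 \<le> n"
  shows "op_circ (dend_comp A) m n f g \<in> cochains dend (m + n - 1)"
  unfolding op_circ_def by (intro C.sum_cochain C.alt_cochain dend_comp_closed) (use assms in auto)

lemma S_map_circ:
  assumes "f \<in> cochains dend m" "1 \<le> n"
  shows "S_map (m + n - 1) (op_circ (dend_comp A) m n f g) =
    op_circ end_comp m n (S_map m f) (S_map n g)"
  unfolding op_circ_def map_sum map_alt by (intro sum.cong) (use assms S_map_dend_comp in auto)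

lemma bracket_closed_dend:
  assumes "f \<in> cochains dend m" "g \<in> cochains dend n" "1 \<le> m" "1 \<le> n"
  shows "op_bracket (dend_comp A) m n f g \<in> cochains dend (m + n - 1)"
  using circ_closed_dend[of f m g n] circ_closed_dend[of g n f m] assms
  by (simp add: op_bracket_def C.diff_cochain C.alt_cochain add.commute)

lemma S_map_bracket:
  assumes "f \<in> cochains dend m" "g \<in> cochains dend n" "1 \<le> m" "1 \<le> n"
  shows "S_map (m + n - 1) (op_bracket (dend_comp A) m n f g) =
    op_bracket end_comp m n (S_map m f) (S_map n g)"
  using S_map_circ[of f m n g] S_map_circ[of g n m f] assms
  by (simp add: op_bracket_def map_diff map_alt add.commute)

lemma pi_comp_closed:
  assumes "g \<in> cochains dend n" "1 \<le> n"
  shows "dend_comp A 2 n 2 (pi_A A) g \<in> cochains dend (n + 1)"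
  using dend_comp_closed[OF pi_A_closed assms(1), of 2] assms by simp

lemma prod_closed_dend:
  assumes "f \<in> cochains dend m" "g \<in> cochains dend n" "1 \<le> m" "1 \<le> n"
  shows "op_prod (dend_comp A) (pi_A A) m n f g \<in> cochains dend (m + n)"
  using dend_comp_closed[OF pi_comp_closed[OF assms(2,4)] assms(1), of 1] assms
  by (simp add: op_prod_def C.alt_cochain add.commute)

lemma S_map_prod:
  assumes "f \<in> cochains dend m" "g \<in> cochains dend n" "1 \<le> m" "1 \<le> n"
  shows "S_map (m + n) (op_prod (dend_comp A) (pi_A A) m n f g) =
    op_prod end_comp \<mu> m n (S_map m f) (S_map n g)"
  using S_map_dend_comp[OF pi_comp_closed[OF assms(2,4)], of 1 m f]
    S_map_dend_comp[OF pi_A_closed, of 2 n g] assms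
  by (simp add: op_prod_def map_alt S_map_pi_A add.commute)

lemma gerst_morphism_S_map:
  "gerst_morphism (dend_coh_gerst A) (hoch_coh_gerst A) (\<lambda>n. induced_map hoch n (S_map n))"
  unfolding gerst_morphism_def
proof (intro conjI allI impI ballI)
  show "graded_linear (dend_coh_gerst A) (hoch_coh_gerst A) (\<lambda>n. induced_map hoch n (S_map n))"
    using graded_linear_cohomology_classes
    by (simp add: graded_linear_def dend_coh_gerst_def hoch_coh_gerst_def coh_gerst_def
        graded_space.defs gerst.defs)
next
  fix m n :: nat and X Y
  assume mn: "1 \<le> m" "1 \<le> n"
    and "X \<in> gcarrier (dend_coh_gerst A) m" "Y \<in> gcarrier (dend_coh_gerst A) n"
  then obtain f g where f: "f \<in> cocycles dend m" "X = coh_class dend m f"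
      and g: "g \<in> cocycles dend n" "Y = coh_class dend n g"
    by (auto simp: dend_coh_gerst_def coh_gerst_def graded_space.defs coh_space_def cohomology_def)
  note Sf = map_cocycle[OF f(1) mn(1)] and Sg = map_cocycle[OF g(1) mn(2)]
  have fg: "f \<in> cochains dend m" "g \<in> cochains dend n"
    using f g by (auto simp: cocycles_def)
  show "induced_map hoch (m + n) (S_map (m + n)) (gprod (dend_coh_gerst A) m n X Y) =
      gprod (hoch_coh_gerst A) m n (induced_map hoch m (S_map m) X) (induced_map hoch n (S_map n) Y)"
    using induced_map_op[where \<phi> = "op_prod (dend_comp A) (pi_A A) m n" and
        \<psi> = "op_prod end_comp \<mu> m n" and k = "m + n",
        OF fg prod_closed_dend[OF _ _ mn] S_map_prod[OF _ _ mn]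
        End.prod_respects_classes[OF Sf Sg mn]] f g
    by (simp add: dend_coh_gerst_def hoch_coh_gerst_def coh_gerst_def
        graded_space.defs gerst.defs induced_map_class[OF fg(1)] induced_map_class[OF fg(2)])
  show "induced_map hoch (m + n - 1) (S_map (m + n - 1)) (gbrk (dend_coh_gerst A) m n X Y) =
      gbrk (hoch_coh_gerst A) m n (induced_map hoch m (S_map m) X) (induced_map hoch n (S_map n) Y)"
    using induced_map_op[where \<phi> = "op_bracket (dend_comp A) m n" and
        \<psi> = "op_bracket end_comp m n" and k = "m + n - 1",
        OF fg bracket_closed_dend[OF _ _ mn] S_map_bracket[OF _ _ mn]
        End.bracket_respects_classes[OF Sf Sg mn]] f g
    by (simp add: dend_coh_gerst_def hoch_coh_gerst_def coh_gerst_def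
        graded_space.defs gerst.defs induced_map_class[OF fg(1)] induced_map_class[OF fg(2)])
qed

end

theorem theorem2p9:
  fixes A :: "('k::field_char_0, 'a::ab_group_add) dendriform"
    and M :: "('k, 'a, 'm::ab_group_add) dend_rep"
  assumes "dendriform_algebra A" and "dend_representation A M"
  defines "CD \<equiv> dend_complex A M"
    and "CH \<equiv> hoch_complex (assoc_of A) (bimod_of M)"
  shows
    "graded_linear (coch_space CD) (coch_space CH) S_map \<and>
     (\<forall>n\<ge>1. \<forall>f\<in>cochains CD n. codiff CH n (S_map n f) = S_map (n + 1) (codiff CD n f)) \<and>
     (\<forall>n\<ge>1. \<forall>f\<in>cocycles CD n.
        S_map n f \<in> cocycles CH n \<and>
        induced_map CH n (S_map n) (coh_class CD n f) = coh_class CH n (S_map n f)) \<and>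
     graded_linear (coh_space CD) (coh_space CH) (\<lambda>n. induced_map CH n (S_map n)) \<and>
     gerst_morphism (dend_coh_gerst A) (hoch_coh_gerst A)
       (\<lambda>n. induced_map (hoch_complex (assoc_of A) (bimod_of (self_rep A))) n (S_map n))"
proof -
  interpret rep: dendriform_representation A M
    using assms(1,2) by unfold_locales
  interpret self: dendriform A
    using assms(1) by unfold_locales
  show ?thesis
    unfolding CD_def CH_def
    using rep.graded_linear_cochains rep.map_codiff rep.map_cocycle rep.induced_map_class
      rep.graded_linear_cohomology_classes self.gerst_morphism_S_map
    by (auto simp: cocycles_def)
qed


end
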